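(* Let $\mathbb{L}$ be the algebra of paracomplex numbers and let $\mathcal{M}^2$ be a timelike minimal surface in the Lorentz-Minkowski space $\mathbb{L}^3$, given by the immersion $\psi:\Omega\to\mathbb{L}^3$, where $\Omega\subset\mathbb{L}$ is a simply connected domain. Then there exists a harmonic function $h:\Omega\subset\mathbb{L}\to\mathbb{R}$ such that the immersed minimal surface $\mathcal{M}$ is an Enneper graph of $h$.
   Context: The paracomplex (Lorentz) numbers are $\mathbb{L}=\{a+\tau\,b : a,b\in\mathbb{R}\}$, where $\tau^2=1$, with the obvious addition and multiplication, conjugation $\overline{a+\tau\,b}=a-\tau\,b$, and the topology of $\mathbb{R}^2$. $\mathbb{L}^3$ is $\mathbb{R}^3$ endowed with the Lorentzian metric $g=dx_1^2+dx_2^2-dx_3^2$, identified with $\mathbb{R}\times\mathbb{L}$ by $(x_1,x_2,x_3)\leftrightarrow(x_1,\,x_2+\tau\,x_3)$. A smooth immersion $\psi:\Omega\to\mathbb{L}^3$ is timelike if the induced metric $ds^2=\psi^*g$ is Lorentzian, and minimal if its mean curvature (the trace of the second fundamental form with respect to the first fundamental form) vanishes identically. The immersion $\psi$ in the claim is not assumed to be conformal in the coordinate in which it is given: $\Omega$ can be endowed with paracomplex isothermal coordinates $z=u+\tau\,v$ for $ds^2$, i.e. such that $ds^2=\lambda\,(du^2-dv^2)$ with $\lambda>0$, and the notions below are taken with respect to such a coordinate $z=u+\tau\,v$ introduced in $\Omega$. Put $$\frac{\partial}{\partial z}=\frac12\left(\frac{\partial}{\partial u}+\tau\,\frac{\partial}{\partial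 v}\right),\qquad \frac{\partial}{\partial\bar z}=\frac12\left(\frac{\partial}{\partial u}-\tau\,\frac{\partial}{\partial v}\right);$$ a subscript $z$ denotes $\partial/\partial z$. A $C^1$ function $f=a+\tau\,b:\Omega\to\mathbb{L}$ (with $a,b$ real valued) is $\mathbb{L}$-differentiable ($\mathbb{L}$-holomorphic) in $\Omega$ if and only if $\partial f/\partial\bar z=0$ in $\Omega$, i.e. $a_u=b_v$ and $a_v=b_u$. A function $h:\Omega\to\mathbb{R}$ is harmonic if $h_{uu}-h_{vv}=0$. Given a harmonic function $h:\Omega\to\mathbb{R}$ on a simply connected domain $\Omega\subset\mathbb{L}$, an Enneper timelike immersion associated to $h$ is a map $z\mapsto(h(z),L(z)-\overline{P(z)})\in\mathbb{R}\times\mathbb{L}\equiv\mathbb{L}^3$, $z\in\Omega$, where $L,P:\Omega\to\mathbb{L}$ are $\mathbb{L}$-differentiable, $(h_z)^2=L_z\,P_z$ and $2\,h_z\,\overline{h_z}+L_z\,\overline{L_z}+P_z\,\overline{P_z}\neq 0$ on $\Omega$. Its image is called an Enneper graph of $h$. *)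

theory Defs
  imports "HOL-Analysis.Analysis"
begin

section \<open>Paracomplex numbers and Lorentz-Minkowski space\<close>

text \<open>The pair \<open>(a, b)\<close> stands for \<open>a + \<tau> b\<close>. Addition and topology are those of the product type.\<close>

type_synonym paracomplex = "real \<times> real"

definition tau :: paracomplex (\<open>\<tau>\<close>) where
  "\<tau> = (0, 1)"

definition pc_of_real :: "real \<Rightarrow> paracomplex" where
  "pc_of_real a = (a, 0)"

definition pc_mult :: "paracomplex \<Rightarrow> paracomplex \<Rightarrow> paracomplex" (infixl \<open>\<odot>\<close> 70) where
  "x \<odot> y = (fst x * fst y + snd x * snd y, fst x * snd y + snd x * fst y)"

definition pc_cnj :: "paracomplex \<Rightarrow> paracomplex" where
  "pc_cnj x = (fst x, - snd x)"

lemma tau_squared: "\<tau> \<odot> \<tau> = pc_of_real 1"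
  by (simp add: tau_def pc_mult_def pc_of_real_def)

text \<open>The identification \<open>(x\<^sub>1, x\<^sub>2, x\<^sub>3) \<leftrightarrow> (x\<^sub>1, x\<^sub>2 + \<tau> x\<^sub>3)\<close> is built into the type.\<close>

type_synonym minkowski3 = "real \<times> paracomplex"

definition mink :: "minkowski3 \<Rightarrow> minkowski3 \<Rightarrow> real" where
  "mink x y = fst x * fst y + fst (snd x) * fst (snd y) - snd (snd x) * snd (snd y)"

section \<open>Timelike minimal immersions\<close>

text \<open>\<open>C\<^sup>k\<close> functions on an open set, through iterated directional derivatives.\<close>

primrec Ck_on :: "nat \<Rightarrow> 'a::real_normed_vector set \<Rightarrow> ('a \<Rightarrow> 'b::real_normed_vector) \<Rightarrow> bool" where
  "Ck_on 0 S f \<longleftrightarrow> continuous_on S f"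
| "Ck_on (Suc k) S f \<longleftrightarrow>
     (\<forall>p\<in>S. f differentiable (at p)) \<and> (\<forall>v. Ck_on k S (\<lambda>p. frechet_derivative f (at p) v))"

definition smooth_on :: "'a::real_normed_vector set \<Rightarrow> ('a \<Rightarrow> 'b::real_normed_vector) \<Rightarrow> bool" where
  "smooth_on S f \<longleftrightarrow> (\<forall>k. Ck_on k S f)"

definition immersion_on ::
    "'a::real_normed_vector set \<Rightarrow> ('a \<Rightarrow> 'b::real_normed_vector) \<Rightarrow> bool" where
  "immersion_on S f \<longleftrightarrow> smooth_on S f \<and> (\<forall>p\<in>S. inj (frechet_derivative f (at p)))"

definition first_form ::
    "(paracomplex \<Rightarrow> minkowski3) \<Rightarrow> paracomplex \<Rightarrow> paracomplex \<Rightarrow> paracomplex \<Rightarrow> real" where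
  "first_form \<psi> p v w = mink (frechet_derivative \<psi> (at p) v) (frechet_derivative \<psi> (at p) w)"

text \<open>Signature \<open>(1, 1)\<close> of a symmetric bilinear form on the plane. The two conditions on \<open>e\<close>
  and \<open>f\<close> force them to be linearly independent, so they form a basis.\<close>

definition lorentzian_form :: "(paracomplex \<Rightarrow> paracomplex \<Rightarrow> real) \<Rightarrow> bool" where
  "lorentzian_form B \<longleftrightarrow> (\<exists>e f. B e e = 1 \<and> B f f = - 1 \<and> B e f = 0)"

definition timelike_immersion :: "paracomplex set \<Rightarrow> (paracomplex \<Rightarrow> minkowski3) \<Rightarrow> bool" where
  "timelike_immersion \<Omega> \<psi> \<longleftrightarrow>
     immersion_on \<Omega> \<psi> \<and> (\<forall>p\<in>\<Omega>. lorentzian_form (first_form \<psi> p))"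

text \<open>For a timelike immersion the normal line is spacelike, so at each point there are exactly
  two unit normals; they differ by a sign.\<close>

definition unit_normal :: "(paracomplex \<Rightarrow> minkowski3) \<Rightarrow> paracomplex \<Rightarrow> minkowski3 \<Rightarrow> bool" where
  "unit_normal \<psi> p N \<longleftrightarrow>
     mink N N = 1 \<and> (\<forall>v. mink (frechet_derivative \<psi> (at p) v) N = 0)"

definition second_form ::
    "(paracomplex \<Rightarrow> minkowski3) \<Rightarrow> minkowski3 \<Rightarrow> paracomplex \<Rightarrow> paracomplex \<Rightarrow> paracomplex \<Rightarrow> real"
  where
  "second_form \<psi> N p v w =
     mink (frechet_derivative (\<lambda>q. frechet_derivative \<psi> (at q) v) (at p) w) N"

text \<open>The trace of \<open>B\<close> with respect to \<open>A\<close>, i.e. the trace of the matrix product of the inverse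
  of the Gram matrix of \<open>A\<close> with the Gram matrix of \<open>B\<close>, in the standard basis.\<close>

definition form_trace ::
    "(paracomplex \<Rightarrow> paracomplex \<Rightarrow> real) \<Rightarrow> (paracomplex \<Rightarrow> paracomplex \<Rightarrow> real) \<Rightarrow> real" where
  "form_trace A B =
     (let e = (1, 0); f = (0, 1) in
       (A f f * B e e - A e f * B f e - A f e * B e f + A e e * B f f)
         / (A e e * A f f - A e f * A f e))"

definition mean_curvature :: "(paracomplex \<Rightarrow> minkowski3) \<Rightarrow> minkowski3 \<Rightarrow> paracomplex \<Rightarrow> real" where
  "mean_curvature \<psi> N p = form_trace (first_form \<psi> p) (second_form \<psi> N p)"

text \<open>Vanishing of the mean curvature does not depend on which of the two unit normals is used.\<close>

definition minimal_on :: "paracomplex set \<Rightarrow> (paracomplex \<Rightarrow> minkowski3) \<Rightarrow> bool" where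
  "minimal_on \<Omega> \<psi> \<longleftrightarrow> (\<forall>p\<in>\<Omega>. \<forall>N. unit_normal \<psi> p N \<longrightarrow> mean_curvature \<psi> N p = 0)"

section \<open>Coordinates and paracomplex derivatives\<close>

text \<open>A coordinate \<open>z = u + \<tau> v\<close> is given as a function on \<open>\<Omega>\<close>, whose points are not themselves
  values of \<open>z\<close>. It is required to be a local diffeomorphism, which is all that the operators
  \<open>\<partial>/\<partial>u\<close> and \<open>\<partial>/\<partial>v\<close> need, but not to be injective: on the universal cover of the punctured
  Minkowski plane, a simply connected surface whose covering map to a timelike plane is a timelike
  minimal immersion, no isothermal coordinate is globally injective.\<close>

definition coordinate_on :: "paracomplex set \<Rightarrow> (paracomplex \<Rightarrow> paracomplex) \<Rightarrow> bool" where
  "coordinate_on \<Omega> z \<longleftrightarrow> smooth_on \<Omega> z \<and> (\<forall>p\<in>\<Omega>. bij (frechet_derivative z (at p)))"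

text \<open>\<open>ds\<^sup>2 = l (du\<^sup>2 - dv\<^sup>2)\<close> with \<open>l > 0\<close>.\<close>

definition isothermal_coordinate ::
    "paracomplex set \<Rightarrow> (paracomplex \<Rightarrow> minkowski3) \<Rightarrow> (paracomplex \<Rightarrow> paracomplex) \<Rightarrow> bool" where
  "isothermal_coordinate \<Omega> \<psi> z \<longleftrightarrow>
     coordinate_on \<Omega> z \<and>
     (\<exists>l. \<forall>p\<in>\<Omega>. l p > 0 \<and>
       (\<forall>w. first_form \<psi> p w w =
              l p * ((fst (frechet_derivative z (at p) w))\<^sup>2
                - (snd (frechet_derivative z (at p) w))\<^sup>2)))"

text \<open>The derivative of \<open>f\<close> along the coordinate vector field of \<open>z\<close> with constant components
  \<open>c\<close>: its value at \<open>p\<close> is the vector that the differential of \<open>z\<close> maps to \<open>c\<close>.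
  In particular \<open>c = (1, 0)\<close> gives \<open>\<partial>f/\<partial>u\<close> and \<open>c = (0, 1)\<close> gives \<open>\<partial>f/\<partial>v\<close>.\<close>

definition coord_deriv ::
    "(paracomplex \<Rightarrow> paracomplex) \<Rightarrow> paracomplex \<Rightarrow> (paracomplex \<Rightarrow> 'b::real_normed_vector)
      \<Rightarrow> paracomplex \<Rightarrow> 'b" where
  "coord_deriv z c f p = frechet_derivative f (at p) (inv (frechet_derivative z (at p)) c)"

abbreviation du where "du z \<equiv> coord_deriv z (1, 0)"
abbreviation dv where "dv z \<equiv> coord_deriv z (0, 1)"

lemma coord_deriv_compose:
  assumes "z differentiable (at p)" "bij (frechet_derivative z (at p))"
    and "F differentiable (at (z p))"
  shows "coord_deriv z c (\<lambda>q. F (z q)) p = frechet_derivative F (at (z p)) c"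
proof -
  have "frechet_derivative (F \<circ> z) (at p) =
      frechet_derivative F (at (z p)) \<circ> frechet_derivative z (at p)"
    using assms by (intro frechet_derivative_compose) auto
  then show ?thesis
    using assms(2) by (simp add: coord_deriv_def o_def bij_is_surj surj_f_inv_f)
qed

definition d_z ::
    "(paracomplex \<Rightarrow> paracomplex) \<Rightarrow> (paracomplex \<Rightarrow> paracomplex) \<Rightarrow> paracomplex \<Rightarrow> paracomplex" where
  "d_z z f p = (1/2) *\<^sub>R (du z f p + \<tau> \<odot> dv z f p)"

definition d_zbar ::
    "(paracomplex \<Rightarrow> paracomplex) \<Rightarrow> (paracomplex \<Rightarrow> paracomplex) \<Rightarrow> paracomplex \<Rightarrow> paracomplex" where
  "d_zbar z f p = (1/2) *\<^sub>R (du z f p - \<tau> \<odot> dv z f p)"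

definition L_differentiable_on ::
    "(paracomplex \<Rightarrow> paracomplex) \<Rightarrow> paracomplex set \<Rightarrow> (paracomplex \<Rightarrow> paracomplex) \<Rightarrow> bool" where
  "L_differentiable_on z \<Omega> f \<longleftrightarrow> Ck_on 1 \<Omega> f \<and> (\<forall>p\<in>\<Omega>. d_zbar z f p = 0)"

definition harmonic_on ::
    "(paracomplex \<Rightarrow> paracomplex) \<Rightarrow> paracomplex set \<Rightarrow> (paracomplex \<Rightarrow> real) \<Rightarrow> bool" where
  "harmonic_on z \<Omega> h \<longleftrightarrow>
     Ck_on 2 \<Omega> h \<and> (\<forall>p\<in>\<Omega>. du z (du z h) p - dv z (dv z h) p = 0)"

section \<open>Enneper immersions and graphs\<close>

definition Enneper_timelike_immersion ::
    "(paracomplex \<Rightarrow> paracomplex) \<Rightarrow> paracomplex set \<Rightarrow> (paracomplex \<Rightarrow> real)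
      \<Rightarrow> (paracomplex \<Rightarrow> minkowski3) \<Rightarrow> bool" where
  "Enneper_timelike_immersion z \<Omega> h X \<longleftrightarrow>
     (\<exists>L P. L_differentiable_on z \<Omega> L \<and> L_differentiable_on z \<Omega> P \<and>
       (\<forall>p\<in>\<Omega>.
         (let hz = d_z z (\<lambda>q. pc_of_real (h q)) p; Lz = d_z z L p; Pz = d_z z P p in
           X p = (h p, L p - pc_cnj (P p)) \<and>
           hz \<odot> hz = Lz \<odot> Pz \<and>
           2 *\<^sub>R (hz \<odot> pc_cnj hz) + Lz \<odot> pc_cnj Lz + Pz \<odot> pc_cnj Pz \<noteq> 0)))"

definition Enneper_graph ::
    "(paracomplex \<Rightarrow> paracomplex) \<Rightarrow> paracomplex set \<Rightarrow> (paracomplex \<Rightarrow> real)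
      \<Rightarrow> minkowski3 set \<Rightarrow> bool" where
  "Enneper_graph z \<Omega> h S \<longleftrightarrow> (\<exists>X. Enneper_timelike_immersion z \<Omega> h X \<and> S = X ` \<Omega>)"

end

theory Submission
  imports Defs "HOL-Complex_Analysis.Riemann_Mapping"
begin

text \<open>A timelike minimal immersion has harmonic components, which means that the 1-form \<open>*d\<psi>\<close> is
  closed, where \<open>*\<close> is the Hodge star of the induced Lorentzian metric. The domain is simply connected,
  so \<open>*d\<psi> = dY\<close> for a conjugate map \<open>Y\<close>. The third components of \<open>Y\<close> and \<open>\<psi>\<close> then form an isothermal
  coordinate. In an arbitrary isothermal coordinate \<open>z = u + \<tau> v\<close> a map \<open>y = \<plusminus>Y\<close> satisfies
  \<open>y\<^sub>u = \<psi>\<^sub>v\<close> and \<open>y\<^sub>v = \<psi>\<^sub>u\<close>, so that \<open>X\<^sub>j = \<psi>\<^sub>j + \<tau> y\<^sub>j\<close> are paracomplex differentiable. The Enneper data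
  are \<open>h = \<psi>\<^sub>1\<close>, \<open>L = (X\<^sub>2 + \<tau> X\<^sub>3) / 2\<close> and \<open>P = - (X\<^sub>2 - \<tau> X\<^sub>3) / 2\<close>: the equation
  \<open>(h\<^sub>z)\<^sup>2 = L\<^sub>z P\<^sub>z\<close> is the conformality of \<open>z\<close>, and the nonvanishing quantity is the conformal factor.\<close>

section \<open>Symmetry of the second derivative\<close>

text \<open>The coordinate \<open>z\<close> is only a local diffeomorphism, so the surface cannot be
  transplanted to the image of \<open>z\<close>. All computations stay on \<Omega>, in given
  coordinates that are not conformal, and differentiation in u and v means differentiation along
  vector fields on \<Omega>. Closedness of \<open>*d\<psi>\<close> says that the Laplacian of the
  induced metric annihilates \<psi>. The tangential part of that Laplacian vanishes for every
  immersion; its normal part is the mean curvature. Exactness of closed real forms depends only on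
  the topology of \<Omega>, so ordinary complex analysis on the same plane set can supply it. The
  star on 1-forms depends only on the conformal class and the orientation; hence one
  \<open>Y\<close>, built without reference to \<open>z\<close>, serves every isothermal coordinate,
  and the sign records whether \<open>z\<close> preserves orientation. Conformality reads X1'^2 +
  X2'^2 - X3'^2 = 0 for the paracomplex derivatives. Since the square of \<tau> is 1, the last two
  terms factor as (X2' + \<tau> X3') (X2' - \<tau> X3'), which dictates \<open>L\<close> and
  \<open>P\<close>.\<close>

lemma frechet_derivativeI:
  assumes "(f has_derivative f') (at p)"
  shows "frechet_derivative f (at p) = f'"
  using frechet_derivative_at[OF assms] by simp

text \<open>The mean value theorem along \<open>v\<close> turns the second difference into
  \<open>t\<close> times a difference of two values of \<open>f' _ v\<close>. Differentiability of
  that function at the single point \<open>p\<close> replaces each value by its affine part, with an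
  error of order e t.\<close>

lemma second_difference_estimate:
  fixes f :: "'a::real_normed_vector \<Rightarrow> real"
  assumes S: "open S" "p \<in> S"
    and f: "\<And>x. x \<in> S \<Longrightarrow> (f has_derivative f' x) (at x)"
    and d: "((\<lambda>x. f' x v) has_derivative A) (at p)"
    and e: "e > 0"
  shows "\<forall>\<^sub>F t in at_right (0::real).
    \<bar>f (p + t *\<^sub>R v + t *\<^sub>R w) - f (p + t *\<^sub>R v) - f (p + t *\<^sub>R w) + f p - t\<^sup>2 * A w\<bar>
      \<le> 2 * e * t\<^sup>2 * (norm v + norm w)"
proof -
  obtain r where r: "r > 0" "ball p r \<subseteq> S"
    using S open_contains_ball by blast
  obtain d where dd: "d > 0"
    "\<And>y. norm (y - p) < d \<Longrightarrow> \<bar>f' y v - f' p v - A (y - p)\<bar> \<le> e * norm (y - p)"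
    using d e unfolding has_derivative_at_alt by (auto simp: real_norm_def)
  \<comment> \<open>For t below \<open>m\<close> the whole parallelogram lies in \<open>S\<close>
    and in the range of the estimate for \<open>f' _ v\<close>; the summand 1 keeps the quotient
    meaningful when both vectors vanish.\<close>
  define m where "m = min r d / (norm v + norm w + 1)"
  have m0: "m > 0"
    unfolding m_def using r dd by (auto intro!: divide_pos_pos add_nonneg_pos)
  have A: "linear A" using d has_derivative_linear by blast
  have main: "\<bar>f (p + t *\<^sub>R v + t *\<^sub>R w) - f (p + t *\<^sub>R v) - f (p + t *\<^sub>R w) + f p - t\<^sup>2 * A w\<bar>
      \<le> 2 * e * t\<^sup>2 * (norm v + norm w)" if t: "0 < t" "t < m" for t
  proof -
    have small: "norm (y - p) \<le> t * (norm v + norm w) \<Longrightarrow> norm (y - p) < min r d" for y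
    proof -
      assume "norm (y - p) \<le> t * (norm v + norm w)"
      also have "\<dots> \<le> t * (norm v + norm w + 1)" using t by simp
      also have "\<dots> < m * (norm v + norm w + 1)"
        using t by (intro mult_strict_right_mono) (auto intro: add_nonneg_pos)
      also have "\<dots> = min r d"
        unfolding m_def using add_nonneg_pos[of "norm v + norm w" 1] by simp
      finally show ?thesis .
    qed
    have n1: "norm ((s * t) *\<^sub>R v + t *\<^sub>R w) \<le> t * (norm v + norm w)"
      and n2: "norm ((s * t) *\<^sub>R v) \<le> t * (norm v + norm w)" if "0 \<le> s" "s \<le> 1" for s
    proof -
      have "norm ((s * t) *\<^sub>R v) \<le> t * norm v"
        using that t by (simp add: mult_left_le_one_le mult_right_mono)
      moreover have "norm (t *\<^sub>R w) = t * norm w" using t by simp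
      ultimately show "norm ((s * t) *\<^sub>R v + t *\<^sub>R w) \<le> t * (norm v + norm w)"
        "norm ((s * t) *\<^sub>R v) \<le> t * (norm v + norm w)"
        using norm_triangle_ineq[of "(s * t) *\<^sub>R v" "t *\<^sub>R w"] t norm_ge_zero[of w]
        by (auto simp: distrib_left intro: order_trans add_increasing2)
    qed
    define k where "k s = f (p + ((s * t) *\<^sub>R v + t *\<^sub>R w)) - f (p + (s * t) *\<^sub>R v)" for s
    have "\<exists>s. 0 < s \<and> s < 1 \<and> k 1 - k 0 =
        (1 - 0) * (t * (f' (p + ((s * t) *\<^sub>R v + t *\<^sub>R w)) v - f' (p + (s * t) *\<^sub>R v) v))"
    proof (rule MVT2)
      fix s :: real assume s: "0 \<le> s" "s \<le> 1"
      have in_S: "p + ((s * t) *\<^sub>R v + t *\<^sub>R w) \<in> S" "p + (s * t) *\<^sub>R v \<in> S"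
        using small[of "p + ((s * t) *\<^sub>R v + t *\<^sub>R w)"] small[of "p + (s * t) *\<^sub>R v"] n1[OF s] n2[OF s] r
        by (auto simp: dist_norm norm_minus_commute subset_iff)
      have lin: "linear (f' x)" if "x \<in> S" for x
        using f[OF that] has_derivative_linear by blast
      show "(k has_real_derivative
          t * (f' (p + ((s * t) *\<^sub>R v + t *\<^sub>R w)) v - f' (p + (s * t) *\<^sub>R v) v)) (at s)"
        unfolding k_def has_field_derivative_def
        by (rule has_derivative_eq_rhs,
            (rule derivative_intros has_derivative_compose[OF _ f] in_S)+)
           (auto simp: fun_eq_iff linear_cmul[OF lin[OF in_S(1)]] linear_cmul[OF lin[OF in_S(2)]]
              right_diff_distrib left_diff_distrib mult_ac)
    qed simp
    then obtain s where s: "0 < s" "s < 1" and keq: "k 1 - k 0 =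
        t * (f' (p + ((s * t) *\<^sub>R v + t *\<^sub>R w)) v - f' (p + (s * t) *\<^sub>R v) v)" by auto
    define y1 y2 where "y1 = p + ((s * t) *\<^sub>R v + t *\<^sub>R w)" and "y2 = p + (s * t) *\<^sub>R v"
    have b: "norm (y1 - p) \<le> t * (norm v + norm w)" "norm (y2 - p) \<le> t * (norm v + norm w)"
      using n1[of s] n2[of s] s unfolding y1_def y2_def by auto
    have "\<bar>f' y1 v - f' p v - A (y1 - p)\<bar> \<le> e * (t * (norm v + norm w))"
      "\<bar>f' y2 v - f' p v - A (y2 - p)\<bar> \<le> e * (t * (norm v + norm w))"
      using dd(2)[of y1] dd(2)[of y2] small[OF b(1)] small[OF b(2)] b e
      by (auto intro: order_trans mult_left_mono)
    moreover have "A (y1 - p) - A (y2 - p) = t * A w"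
      unfolding linear_diff[OF A, symmetric] y1_def y2_def using linear_cmul[OF A] by simp
    ultimately have "\<bar>f' y1 v - f' y2 v - t * A w\<bar> \<le> 2 * (e * (t * (norm v + norm w)))"
      by linarith
    then have "t * \<bar>f' y1 v - f' y2 v - t * A w\<bar> \<le> t * (2 * (e * (t * (norm v + norm w))))"
      using t by (intro mult_left_mono) auto
    moreover have "t * \<bar>f' y1 v - f' y2 v - t * A w\<bar> = \<bar>k 1 - k 0 - t\<^sup>2 * A w\<bar>"
      unfolding keq y1_def y2_def using t abs_mult_pos[of t]
      by (simp add: algebra_simps power2_eq_square flip: abs_mult_pos')
    moreover have "k 1 - k 0 = f (p + t *\<^sub>R v + t *\<^sub>R w) - f (p + t *\<^sub>R v) - f (p + t *\<^sub>R w) + f p"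
      unfolding k_def by (simp add: add.assoc)
    ultimately show ?thesis by (simp add: power2_eq_square algebra_simps)
  qed
  show ?thesis
    unfolding eventually_at_right_field using main m0 by blast
qed

text \<open>The second difference is symmetric in \<open>v\<close> and \<open>w\<close>, and both
  \<open>t\<^sup>2 * A w\<close> and \<open>t\<^sup>2 * B v\<close> approximate it up to
  o(t^2).\<close>

lemma second_derivative_symmetric_real:
  fixes f :: "'a::real_normed_vector \<Rightarrow> real"
  assumes S: "open S" "p \<in> S"
    and f: "\<And>x. x \<in> S \<Longrightarrow> (f has_derivative f' x) (at x)"
    and A: "((\<lambda>x. f' x v) has_derivative A) (at p)"
    and B: "((\<lambda>x. f' x w) has_derivative B) (at p)"
  shows "A w = B v"
proof (rule ccontr)
  assume ne: "A w \<noteq> B v"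
  define c where "c = norm v + norm w + 1"
  have c: "c > 0" unfolding c_def by (simp add: add_nonneg_pos)
  \<comment> \<open>The two estimates together allow an error of 4 e c t^2; the factor 8 makes this
    half of the supposed gap.\<close>
  define e where "e = \<bar>A w - B v\<bar> / (8 * c)"
  have e: "e > 0" unfolding e_def using ne c by simp
  have "\<forall>\<^sub>F t in at_right (0::real). t > 0"
    by (simp add: eventually_at_right_less)
  moreover have "\<forall>\<^sub>F t in at_right (0::real).
      \<bar>f (p + t *\<^sub>R v + t *\<^sub>R w) - f (p + t *\<^sub>R v) - f (p + t *\<^sub>R w) + f p - t\<^sup>2 * A w\<bar>
        \<le> 2 * e * t\<^sup>2 * (norm v + norm w)"
    by (rule second_difference_estimate[where f' = f', OF S _ A e]) (rule f)
  moreover have "\<forall>\<^sub>F t in at_right (0::real).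
      \<bar>f (p + t *\<^sub>R w + t *\<^sub>R v) - f (p + t *\<^sub>R w) - f (p + t *\<^sub>R v) + f p - t\<^sup>2 * B v\<bar>
        \<le> 2 * e * t\<^sup>2 * (norm w + norm v)"
    by (rule second_difference_estimate[where f' = f', OF S _ B e]) (rule f)
  ultimately have "\<forall>\<^sub>F t in at_right (0::real). False"
  proof eventually_elim
    case (elim t)
    have "t\<^sup>2 * \<bar>A w - B v\<bar> = \<bar>t\<^sup>2 * A w - t\<^sup>2 * B v\<bar>"
      by (simp add: abs_mult right_diff_distrib[symmetric])
    also have "\<dots> \<le> 2 * (2 * e * t\<^sup>2 * (norm v + norm w))"
      using elim(2,3) by (simp add: add.commute add.left_commute)
    also have "\<dots> \<le> 2 * (2 * e * t\<^sup>2 * c)"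
      unfolding c_def using e by (intro mult_left_mono) auto
    also have "\<dots> = t\<^sup>2 * (\<bar>A w - B v\<bar> / 2)"
      unfolding e_def using c by (simp add: field_simps)
    finally show False using elim(1) ne by (simp add: mult_le_cancel_left)
  qed
  then show False by simp
qed

lemma second_derivative_symmetric:
  fixes f :: "'a::real_normed_vector \<Rightarrow> 'b::real_inner"
  assumes S: "open S" "p \<in> S"
    and f: "\<And>x. x \<in> S \<Longrightarrow> (f has_derivative f' x) (at x)"
    and A: "((\<lambda>x. f' x v) has_derivative A) (at p)"
    and B: "((\<lambda>x. f' x w) has_derivative B) (at p)"
  shows "A w = B v"
proof (rule vector_eq_ldot[THEN iffD1], rule allI)
  fix b
  show "b \<bullet> A w = b \<bullet> B v"
    by (rule second_derivative_symmetric_real[OF S, where f = "\<lambda>x. b \<bullet> f x" and f' = "\<lambda>x v. b \<bullet> f' x v"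
          and A = "\<lambda>v. b \<bullet> A v" and B = "\<lambda>v. b \<bullet> B v"])
      (intro has_derivative_inner_right f A B; assumption)+
qed

section \<open>Smooth functions\<close>

text \<open>Since \<open>S\<close> is open, the derivative at a point of \<open>S\<close> ignores
  values off \<open>S\<close>, and the induction passes this on to iterated derivatives.\<close>

lemma Ck_on_cong:
  assumes "open S" "\<And>x. x \<in> S \<Longrightarrow> f x = g x"
  shows "Ck_on k S f \<longleftrightarrow> Ck_on k S g"
proof -
  have "Ck_on k S f" if "Ck_on k S g" "\<And>x. x \<in> S \<Longrightarrow> f x = g x"
    for f g :: "'a \<Rightarrow> 'b"
    using that
  proof (induction k arbitrary: f g)
    case 0
    then show ?case using continuous_on_cong[OF refl, of S f g] by simp
  next
    case (Suc k)
    have d: "(f has_derivative frechet_derivative g (at p)) (at p)" if "p \<in> S" for p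
      using Suc.prems that assms(1)
      by (intro has_derivative_transform_within_open[of g _ _ UNIV S f])
         (auto simp flip: frechet_derivative_works)
    show ?case
      using Suc.prems d Suc.IH[of "\<lambda>p. frechet_derivative g (at p) v" "\<lambda>p. frechet_derivative f (at p) v" for v]
      by (auto intro: differentiableI simp: frechet_derivativeI[OF d])
  qed
  from this[of f g] this[of g f] assms(2) show ?thesis by auto
qed

lemma Ck_on_Suc_imp_Ck_on: "Ck_on (Suc k) S f \<Longrightarrow> Ck_on k S f"
proof (induction k arbitrary: f)
  case 0
  then show ?case
    by (auto intro!: continuous_at_imp_continuous_on differentiable_imp_continuous_within)
qed auto

text \<open>Lets an explicit formula stand in for \<open>frechet_derivative\<close>; the closure
  properties below are inductions through this rule.\<close>

lemma Ck_on_SucI: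
  assumes "open S" "\<And>p. p \<in> S \<Longrightarrow> (f has_derivative f' p) (at p)"
    and "\<And>v. Ck_on k S (\<lambda>p. f' p v)"
  shows "Ck_on (Suc k) S f"
  using assms Ck_on_cong[OF assms(1), of "\<lambda>p. frechet_derivative f (at p) v" "\<lambda>p. f' p v" for v]
  by (auto intro: differentiableI simp: frechet_derivativeI[OF assms(2)])

section \<open>Closure properties of C^k and smooth functions\<close>

lemma Ck_on_const: "Ck_on k S (\<lambda>x. c)"
  by (induction k arbitrary: c) auto

lemma Ck_on_linear:
  assumes "open S" "bounded_linear L" "Ck_on k S f"
  shows "Ck_on k S (\<lambda>x. L (f x))"
  using assms(3)
proof (induction k arbitrary: f)
  case 0
  then show ?case using assms(2) by (auto intro: bounded_linear.continuous_on)
next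
  case (Suc k)
  show ?case
    by (rule Ck_on_SucI[OF assms(1), where f' = "\<lambda>p v. L (frechet_derivative f (at p) v)"])
       (use Suc assms(2) in \<open>auto intro: bounded_linear.has_derivative simp flip: frechet_derivative_works\<close>)
qed

lemma Ck_on_add:
  assumes "open S" "Ck_on k S f" "Ck_on k S g"
  shows "Ck_on k S (\<lambda>x. f x + g x)"
  using assms(2,3)
proof (induction k arbitrary: f g)
  case 0
  then show ?case by (auto intro: continuous_on_add)
next
  case (Suc k)
  show ?case
    by (rule Ck_on_SucI[OF assms(1), where f' = "\<lambda>p v. frechet_derivative f (at p) v + frechet_derivative g (at p) v"])
       (use Suc in \<open>auto intro: has_derivative_add simp flip: frechet_derivative_works\<close>)
qed

lemma Ck_on_bilinear:
  assumes "open S" "bounded_bilinear B" "Ck_on k S f" "Ck_on k S g"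
  shows "Ck_on k S (\<lambda>x. B (f x) (g x))"
  using assms(3,4)
proof (induction k arbitrary: f g)
  case 0
  then show ?case using bounded_bilinear.continuous_on[OF assms(2)] by auto
next
  case (Suc k)
  show ?case
    by (rule Ck_on_SucI[OF assms(1), where f' = "\<lambda>p v. B (f p) (frechet_derivative g (at p) v)
          + B (frechet_derivative f (at p) v) (g p)"])
       (use Suc Ck_on_Suc_imp_Ck_on[of k S f] Ck_on_Suc_imp_Ck_on[of k S g] in
         \<open>auto intro!: bounded_bilinear.FDERIV[OF assms(2)] Ck_on_add[OF assms(1)] simp flip: frechet_derivative_works\<close>)
qed

text \<open>The induction generalises the exponent because differentiation lowers it by one. Real
  exponents cover square root and reciprocal at once.\<close>

lemma Ck_on_powr:
  fixes f :: "'a::real_normed_vector \<Rightarrow> real"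
  assumes "open S" "Ck_on k S f" "\<And>x. x \<in> S \<Longrightarrow> f x > 0"
  shows "Ck_on k S (\<lambda>x. f x powr r)"
  using assms(2)
proof (induction k arbitrary: r)
  case 0
  then show ?case using assms(3) by (force intro!: continuous_on_powr' continuous_intros simp: less_imp_le)
next
  case (Suc k)
  show ?case
  proof (rule Ck_on_SucI[OF assms(1), where f' = "\<lambda>p v. r * (f p powr (r - 1) * frechet_derivative f (at p) v)"])
    fix p assume p: "p \<in> S"
    have "(f has_derivative frechet_derivative f (at p)) (at p)"
      using Suc.prems p by (auto simp flip: frechet_derivative_works)
    from has_derivative_powr[OF this has_derivative_const[of r] assms(3)[OF p] UNIV_I]
    show "((\<lambda>x. f x powr r) has_derivative (\<lambda>v. r * (f p powr (r - 1) * frechet_derivative f (at p) v))) (at p)"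
      using assms(3)[OF p] by (simp add: powr_diff mult.commute mult.left_commute)
  next
    fix v
    show "Ck_on k S (\<lambda>p. r * (f p powr (r - 1) * frechet_derivative f (at p) v))"
      using Suc Ck_on_Suc_imp_Ck_on[of k S f]
      by (auto intro!: Ck_on_bilinear[OF assms(1) bounded_bilinear_mult] Ck_on_const)
  qed
qed

lemma smooth_on_cong:
  assumes "open S" "\<And>x. x \<in> S \<Longrightarrow> f x = g x"
  shows "smooth_on S f \<longleftrightarrow> smooth_on S g"
  using Ck_on_cong[OF assms] by (simp add: smooth_on_def)

lemma smooth_on_linear:
  "open S \<Longrightarrow> bounded_linear L \<Longrightarrow> smooth_on S f \<Longrightarrow> smooth_on S (\<lambda>x. L (f x))"
  by (simp add: smooth_on_def Ck_on_linear)

lemma smooth_on_add: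
  "open S \<Longrightarrow> smooth_on S f \<Longrightarrow> smooth_on S g \<Longrightarrow> smooth_on S (\<lambda>x. f x + g x)"
  by (simp add: smooth_on_def Ck_on_add)

lemma smooth_on_bilinear:
  "open S \<Longrightarrow> bounded_bilinear B \<Longrightarrow> smooth_on S f \<Longrightarrow> smooth_on S g
    \<Longrightarrow> smooth_on S (\<lambda>x. B (f x) (g x))"
  by (simp add: smooth_on_def Ck_on_bilinear)

lemma smooth_on_diff:
  "open S \<Longrightarrow> smooth_on S f \<Longrightarrow> smooth_on S g \<Longrightarrow> smooth_on S (\<lambda>x. f x - g x)"
  using smooth_on_add[of S f "\<lambda>x. - g x"] smooth_on_linear[OF _ bounded_linear_minus[OF bounded_linear_ident], of S g]
  by simp

lemma smooth_on_powr:
  fixes f :: "'a::real_normed_vector \<Rightarrow> real"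
  shows "open S \<Longrightarrow> smooth_on S f \<Longrightarrow> (\<And>x. x \<in> S \<Longrightarrow> f x > 0) \<Longrightarrow> smooth_on S (\<lambda>x. f x powr r)"
  by (simp add: smooth_on_def Ck_on_powr)

lemma smooth_on_sqrt:
  fixes f :: "'a::real_normed_vector \<Rightarrow> real"
  assumes "open S" "smooth_on S f" "\<And>x. x \<in> S \<Longrightarrow> f x > 0"
  shows "smooth_on S (\<lambda>x. sqrt (f x))"
  using smooth_on_powr[OF assms, of "1/2"] assms(3)
  by (subst smooth_on_cong[OF assms(1), of _ "\<lambda>x. f x powr (1/2)"]) (auto simp: powr_half_sqrt less_imp_le)

lemma smooth_on_inverse:
  fixes f :: "'a::real_normed_vector \<Rightarrow> real"
  assumes "open S" "smooth_on S f" "\<And>x. x \<in> S \<Longrightarrow> f x > 0"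
  shows "smooth_on S (\<lambda>x. inverse (f x))"
  using smooth_on_powr[OF assms, of "-1"] assms(3)
  by (subst smooth_on_cong[OF assms(1), of _ "\<lambda>x. f x powr (-1)"]) (auto simp: powr_minus less_imp_le)

lemma smooth_on_Pair:
  assumes "open S" "smooth_on S f" "smooth_on S g"
  shows "smooth_on S (\<lambda>x. (f x, g x))"
proof -
  have "bounded_linear (\<lambda>y. (y, 0))" "bounded_linear (\<lambda>y. (0, y))"
    by (auto intro: bounded_linear_Pair bounded_linear_ident bounded_linear_zero)
  from smooth_on_add[OF assms(1) smooth_on_linear[OF assms(1) this(1) assms(2)]
      smooth_on_linear[OF assms(1) this(2) assms(3)]]
  show ?thesis by simp
qed

lemma smooth_on_frechet_derivative:
  "smooth_on S f \<Longrightarrow> smooth_on S (\<lambda>p. frechet_derivative f (at p) v)"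
  unfolding smooth_on_def by (metis Ck_on.simps(2))

lemma smooth_on_has_derivative:
  "smooth_on S f \<Longrightarrow> p \<in> S \<Longrightarrow> (f has_derivative frechet_derivative f (at p)) (at p)"
  unfolding smooth_on_def frechet_derivative_works[symmetric] by (metis Ck_on.simps(2))

text \<open>Serves to show that a primitive of a smooth 1-form is smooth.\<close>

lemma smooth_onI:
  assumes "open S" "\<And>p. p \<in> S \<Longrightarrow> (f has_derivative f' p) (at p)"
    and "\<And>v. smooth_on S (\<lambda>p. f' p v)"
  shows "smooth_on S f"
proof -
  have "Ck_on (Suc k) S f" for k
    using assms by (intro Ck_on_SucI) (auto simp: smooth_on_def)
  then show ?thesis
    unfolding smooth_on_def using Ck_on_Suc_imp_Ck_on by blast
qed

section \<open>Closed 1-forms on simply connected plane domains\<close>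

text \<open>Poincare lemma by radial integration from 0. Symmetry of \<open>\<omega>'\<close> makes
  the derivative of the integrand with respect to the point equal to the t-derivative of
  \<open>t *\<^sub>R \<omega> (t *\<^sub>R p)\<close>, whose integral over the unit interval is
  \<open>\<omega> p\<close>.\<close>

lemma closed_form_exact_convex:
  fixes \<omega> :: "'a::euclidean_space \<Rightarrow> 'a \<Rightarrow>\<^sub>L 'b::euclidean_space"
  assumes S: "open S" "convex S" "0 \<in> S"
    and d: "\<And>p. p \<in> S \<Longrightarrow> (\<omega> has_derivative \<omega>' p) (at p)"
    and cont: "continuous_on (S \<times> UNIV) (\<lambda>(p, v). \<omega>' p v)"
    and sym: "\<And>p v w. p \<in> S \<Longrightarrow> \<omega>' p v w = \<omega>' p w v"
  shows "\<exists>F. \<forall>p\<in>S. (F has_derivative \<omega> p) (at p)"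
proof -
  define F where "F p = integral (cbox (0::real) 1) (\<lambda>t. \<omega> (t *\<^sub>R p) p)" for p
  define fx where "fx p t = \<omega> (t *\<^sub>R p) + t *\<^sub>R \<omega>' (t *\<^sub>R p) p" for p and t :: real
  have in_S: "t *\<^sub>R p \<in> S" if "p \<in> S" "t \<in> cbox 0 1" for t :: real and p
    using convexD_alt[OF S(2,3) that(1), of t] that(2) by auto
  have cS: "continuous_on S \<omega>"
    using d by (auto intro!: continuous_at_imp_continuous_on has_derivative_continuous)
  have lin: "linear (\<omega>' p)" if "p \<in> S" for p
    using d[OF that] has_derivative_linear by blast
  have "(F has_derivative \<omega> p) (at p)" if p: "p \<in> S" for p
  proof -
    have "(F has_derivative integral (cbox 0 1) (fx p)) (at p within S)"
      unfolding F_def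
    proof (rule leibniz_rule[OF _ _ _ p S(2)])
      fix q :: 'a and t :: real assume q: "q \<in> S" and t: "t \<in> cbox 0 1"
      have "((\<lambda>x. \<omega> (t *\<^sub>R x)) has_derivative (\<lambda>v. \<omega>' (t *\<^sub>R q) (t *\<^sub>R v))) (at q)"
        by (rule has_derivative_compose[where g = \<omega> and f = "\<lambda>x. t *\<^sub>R x", OF _ d[OF in_S[OF q t]]]) (auto intro!: derivative_eq_intros)
      from bounded_bilinear.FDERIV[OF bounded_bilinear_blinfun_apply this has_derivative_ident]
      have "((\<lambda>x. \<omega> (t *\<^sub>R x) x) has_derivative (\<lambda>v. \<omega> (t *\<^sub>R q) v + \<omega>' (t *\<^sub>R q) (t *\<^sub>R v) q)) (at q)"
        by simp
      moreover have "(\<lambda>v. \<omega> (t *\<^sub>R q) v + \<omega>' (t *\<^sub>R q) (t *\<^sub>R v) q) = blinfun_apply (fx q t)"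
        unfolding fx_def using sym[OF in_S[OF q t]] linear_cmul[OF lin[OF in_S[OF q t]]]
        by (simp add: fun_eq_iff blinfun.add_left blinfun.scaleR_left)
      ultimately show "((\<lambda>x. \<omega> (t *\<^sub>R x) x) has_derivative blinfun_apply (fx q t)) (at q within S)"
        by (simp add: has_derivative_at_withinI)
    next
      fix q assume q: "q \<in> S"
      show "(\<lambda>t. \<omega> (t *\<^sub>R q) q) integrable_on cbox 0 1"
        using in_S[OF q]
        by (intro integrable_continuous continuous_intros continuous_on_compose2[OF cS]) auto
    next
      have "continuous_on (S \<times> cbox 0 1) (\<lambda>x. \<omega>' (snd x *\<^sub>R fst x) (fst x))"
        using continuous_on_compose2[OF cont, of "S \<times> cbox 0 1" "\<lambda>x. (snd x *\<^sub>R fst x, fst x)"] in_S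
        by (force intro!: continuous_intros)
      then have "continuous_on (S \<times> cbox 0 1) (\<lambda>x. fx (fst x) (snd x))"
        unfolding fx_def using in_S
        by (intro continuous_intros continuous_on_compose2[OF cS]) auto
      then show "continuous_on (S \<times> cbox 0 1) (\<lambda>(x, t). fx x t)"
        by (simp add: case_prod_beta)
    qed
    moreover have "(fx p has_integral 1 *\<^sub>R \<omega> (1 *\<^sub>R p) - 0 *\<^sub>R \<omega> (0 *\<^sub>R p)) {0..1}"
    proof (rule fundamental_theorem_of_calculus)
      fix t :: real assume t: "t \<in> {0..1}"
      then have tS: "t *\<^sub>R p \<in> S" using in_S[OF p] by auto
      have "((\<lambda>s. s *\<^sub>R \<omega> (s *\<^sub>R p)) has_derivative
          (\<lambda>h. t *\<^sub>R \<omega>' (t *\<^sub>R p) (h *\<^sub>R p) + h *\<^sub>R \<omega> (t *\<^sub>R p))) (at t)"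
        by (intro bounded_bilinear.FDERIV[OF bounded_bilinear_scaleR] has_derivative_compose[where g = \<omega> and f = "\<lambda>x. x *\<^sub>R p", OF _ d[OF tS]])
           (auto intro!: derivative_eq_intros)
      then show "((\<lambda>s. s *\<^sub>R \<omega> (s *\<^sub>R p)) has_vector_derivative fx p t) (at t within {0..1})"
        unfolding has_vector_derivative_def fx_def using linear_cmul[OF lin[OF tS]]
        by (auto simp: algebra_simps intro: has_derivative_at_withinI)
    qed simp
    then have "integral (cbox 0 1) (fx p) = \<omega> p"
      by (simp add: integral_unique)
    ultimately show ?thesis
      using at_within_open[OF p S(1)] by simp
  qed
  then show ?thesis by blast
qed

lemma linear_complex_expand:
  fixes f :: "complex \<Rightarrow> real"
  assumes "linear f"
  shows "f v = Re v * f 1 + Im v * f \<i>"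
proof -
  have "v = Re v *\<^sub>R 1 + Im v *\<^sub>R \<i>" by (simp add: complex_eq_iff)
  then have "f v = f (Re v *\<^sub>R 1 + Im v *\<^sub>R \<i>)" by simp
  then show ?thesis by (simp only: linear_add[OF assms] linear_cmul[OF assms] real_scaleR_def)
qed

lemma closed_form_exact_convex_complex:
  fixes P Q :: "complex \<Rightarrow> real"
  assumes S: "open S" "convex S" "0 \<in> S"
    and P: "\<And>p. p \<in> S \<Longrightarrow> (P has_derivative P' p) (at p)"
    and Q: "\<And>p. p \<in> S \<Longrightarrow> (Q has_derivative Q' p) (at p)"
    and cont: "\<And>v. continuous_on S (\<lambda>p. P' p v)" "\<And>v. continuous_on S (\<lambda>p. Q' p v)"
    and closed: "\<And>p. p \<in> S \<Longrightarrow> P' p \<i> = Q' p 1"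
  shows "\<exists>F. \<forall>p\<in>S. (F has_derivative (\<lambda>v. P p * Re v + Q p * Im v)) (at p)"
proof -
  define R I where "R = Blinfun Re" and "I = Blinfun Im"
  have RI: "blinfun_apply R = Re" "blinfun_apply I = Im"
    unfolding R_def I_def by (auto simp: bounded_linear_Blinfun_apply bounded_linear_Re bounded_linear_Im)
  have expand: "P' p v = Re v * P' p 1 + Im v * P' p \<i>" "Q' p v = Re v * Q' p 1 + Im v * Q' p \<i>"
    if "p \<in> S" for p v
    using P[OF that] Q[OF that] by (auto intro: linear_complex_expand has_derivative_linear)
  have "\<exists>F. \<forall>p\<in>S. (F has_derivative blinfun_apply (P p *\<^sub>R R + Q p *\<^sub>R I)) (at p)"
  proof (rule closed_form_exact_convex[OF S, where \<omega>' = "\<lambda>p v. P' p v *\<^sub>R R + Q' p v *\<^sub>R I"])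
    fix p assume "p \<in> S"
    then show "((\<lambda>p. P p *\<^sub>R R + Q p *\<^sub>R I) has_derivative (\<lambda>v. P' p v *\<^sub>R R + Q' p v *\<^sub>R I)) (at p)"
      by (auto intro!: derivative_eq_intros P Q)
  next
    \<comment> \<open>The hypotheses give continuity for each fixed direction only; expansion in the
      basis 1, i upgrades it to joint continuity in point and direction.\<close>
    have "continuous_on (S \<times> UNIV) (\<lambda>x. (Re (snd x) * P' (fst x) 1 + Im (snd x) * P' (fst x) \<i>) *\<^sub>R R
        + (Re (snd x) * Q' (fst x) 1 + Im (snd x) * Q' (fst x) \<i>) *\<^sub>R I)"
      by (intro continuous_intros continuous_on_compose2[OF cont(1)] continuous_on_compose2[OF cont(2)]) auto
    then show "continuous_on (S \<times> UNIV) (\<lambda>(p, v). P' p v *\<^sub>R R + Q' p v *\<^sub>R I)"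
    proof (rule continuous_on_eq)
      fix x :: "complex \<times> complex" assume "x \<in> S \<times> UNIV"
      then show "(Re (snd x) * P' (fst x) 1 + Im (snd x) * P' (fst x) \<i>) *\<^sub>R R
        + (Re (snd x) * Q' (fst x) 1 + Im (snd x) * Q' (fst x) \<i>) *\<^sub>R I
        = (case x of (p, v) \<Rightarrow> P' p v *\<^sub>R R + Q' p v *\<^sub>R I)"
        using expand[of "fst x" "snd x"] by (simp add: case_prod_beta mem_Times_iff)
    qed
  next
    fix p v w assume p: "p \<in> S"
    show "(P' p v *\<^sub>R R + Q' p v *\<^sub>R I) w = (P' p w *\<^sub>R R + Q' p w *\<^sub>R I) v"
      unfolding blinfun.add_left blinfun.scaleR_left RI expand[OF p, of v] expand[OF p, of w] closed[OF p]
      by (simp add: algebra_simps)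
  qed
  moreover have "blinfun_apply (P p *\<^sub>R R + Q p *\<^sub>R I) = (\<lambda>v. P p * Re v + Q p * Im v)" for p
    by (simp add: fun_eq_iff blinfun.add_left blinfun.scaleR_left RI)
  ultimately show ?thesis by simp
qed

text \<open>The Riemann mapping theorem reduces the simply connected case to the convex one: the pullback of a
  closed form under a biholomorphism from the disc is closed.\<close>

lemma closed_form_exact_complex:
  fixes P Q :: "complex \<Rightarrow> real"
  assumes S: "open S" "simply_connected S"
    and P: "\<And>p. p \<in> S \<Longrightarrow> (P has_derivative P' p) (at p)"
    and Q: "\<And>p. p \<in> S \<Longrightarrow> (Q has_derivative Q' p) (at p)"
    and cont: "\<And>v. continuous_on S (\<lambda>p. P' p v)" "\<And>v. continuous_on S (\<lambda>p. Q' p v)"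
    and closed: "\<And>p. p \<in> S \<Longrightarrow> P' p \<i> = Q' p 1"
  shows "\<exists>F. \<forall>p\<in>S. (F has_derivative (\<lambda>v. P p * Re v + Q p * Im v)) (at p)"
proof -
  consider "S = {}" | "S = UNIV" |
    f g where "f holomorphic_on S" "g holomorphic_on ball 0 1"
      "\<And>z. z \<in> S \<Longrightarrow> f z \<in> ball 0 1 \<and> g (f z) = z"
      "\<And>z. z \<in> ball 0 1 \<Longrightarrow> g z \<in> S \<and> f (g z) = z"
    using S(2) unfolding simply_connected_eq_biholomorphic_to_disc[OF S(1)] by blast
  then show ?thesis
  proof cases
    case 2
    then show ?thesis
      using closed_form_exact_convex_complex[of UNIV P P' Q Q'] P Q cont closed by simp
  next
    case 3
    note f = 3(1) and g = 3(2) and fg = 3(3) and gf = 3(4)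
    define D where "D = ball (0::complex) 1"
    have D: "open D" "convex D" "0 \<in> D" unfolding D_def by auto
    define g' where "g' = deriv g"
    have g1: "(g has_derivative (\<lambda>v. g' z * v)) (at z)" if "z \<in> D" for z
      using holomorphic_derivI[OF g _ that[unfolded D_def]] by (simp add: g'_def has_field_derivative_def)
    have hg': "g' holomorphic_on D"
      unfolding D_def g'_def by (rule holomorphic_deriv[OF g]) simp
    have g2: "(g' has_derivative (\<lambda>v. deriv g' z * v)) (at z)" if "z \<in> D" for z
      using holomorphic_derivI[OF hg' D(1) that] by (simp add: has_field_derivative_def)
    have cg: "continuous_on D g" "continuous_on D g'" "continuous_on D (deriv g')"
      using g hg' holomorphic_deriv[OF hg' D(1)] by (auto intro: holomorphic_on_imp_continuous_on simp: D_def)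
    have gD: "g z \<in> S" if "z \<in> D" for z using gf that by (simp add: D_def)
    \<comment> \<open>\<open>A\<close> and \<open>B\<close> are the coefficients of the pullback
      under \<open>g\<close>: expand \<open>P * Re (g' z * v) + Q * Im (g' z * v)\<close> in
      \<open>Re v\<close> and \<open>Im v\<close>.\<close>
    define A where "A z = P (g z) * Re (g' z) + Q (g z) * Im (g' z)" for z
    define B where "B z = Q (g z) * Re (g' z) - P (g z) * Im (g' z)" for z
    define A' where "A' z v = (P (g z) * Re (deriv g' z * v) + P' (g z) (g' z * v) * Re (g' z)) +
      (Q (g z) * Im (deriv g' z * v) + Q' (g z) (g' z * v) * Im (g' z))" for z v
    define B' where "B' z v = (Q (g z) * Re (deriv g' z * v) + Q' (g z) (g' z * v) * Re (g' z)) -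
      (P (g z) * Im (deriv g' z * v) + P' (g z) (g' z * v) * Im (g' z))" for z v
    have expand: "P' p v = Re v * P' p 1 + Im v * P' p \<i>" "Q' p v = Re v * Q' p 1 + Im v * Q' p \<i>"
      if "p \<in> S" for p v
    using P[OF that] Q[OF that] by (auto intro: linear_complex_expand has_derivative_linear)
    have cP: "continuous_on S P" "continuous_on S Q"
      using P Q by (auto intro!: continuous_at_imp_continuous_on has_derivative_continuous)
    have "\<exists>F. \<forall>z\<in>D. (F has_derivative (\<lambda>v. A z * Re v + B z * Im v)) (at z)"
    proof (rule closed_form_exact_convex_complex[OF D, where P' = A' and Q' = B'])
      fix z assume z: "z \<in> D"
      note comp = has_derivative_compose[OF g1[OF z] P[OF gD[OF z]]]
        has_derivative_compose[OF g1[OF z] Q[OF gD[OF z]]]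
      have RI: "((\<lambda>z. Re (g' z)) has_derivative (\<lambda>v. Re (deriv g' z * v))) (at z)"
        "((\<lambda>z. Im (g' z)) has_derivative (\<lambda>v. Im (deriv g' z * v))) (at z)"
        by (intro derivative_intros g2 z)+
      show "(A has_derivative A' z) (at z)" "(B has_derivative B' z) (at z)"
        unfolding A_def B_def A'_def B'_def
        by (intro has_derivative_add has_derivative_diff has_derivative_mult comp RI)+
      \<comment> \<open>The terms with the second derivative of \<open>g\<close> cancel because it
        is complex linear; the rest is the squared modulus of \<open>g'\<close> times the closedness
        defect at \<open>g z\<close>.\<close>
      show "A' z \<i> = B' z 1"
        unfolding A'_def B'_def expand[OF gD[OF z], of "g' z * _"] using closed[OF gD[OF z]]
        by (simp add: algebra_simps)
    next
      fix v
      have c: "continuous_on D (\<lambda>z. P (g z))" "continuous_on D (\<lambda>z. Q (g z))"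
        "\<And>w. continuous_on D (\<lambda>z. P' (g z) w)" "\<And>w. continuous_on D (\<lambda>z. Q' (g z) w)"
        using gD by (intro continuous_on_compose2[OF cP(1) cg(1)] continuous_on_compose2[OF cP(2) cg(1)]
          continuous_on_compose2[OF cont(1) cg(1)] continuous_on_compose2[OF cont(2) cg(1)]; auto)+
      have c': "continuous_on D (\<lambda>z. P' (g z) (g' z * v))" "continuous_on D (\<lambda>z. Q' (g z) (g' z * v))"
      proof -
        have "continuous_on D (\<lambda>z. Re (g' z * v) * P' (g z) 1 + Im (g' z * v) * P' (g z) \<i>)"
          "continuous_on D (\<lambda>z. Re (g' z * v) * Q' (g z) 1 + Im (g' z * v) * Q' (g z) \<i>)"
          by (intro continuous_intros c cg)+
        then show "continuous_on D (\<lambda>z. P' (g z) (g' z * v))" "continuous_on D (\<lambda>z. Q' (g z) (g' z * v))"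
          by - (rule continuous_on_eq, assumption, simp only: expand[OF gD, symmetric])+
      qed
      show "continuous_on D (\<lambda>z. A' z v)" "continuous_on D (\<lambda>z. B' z v)"
        unfolding A'_def B'_def by (intro continuous_intros c c' cg)+
    qed
    then obtain F where F: "\<And>z. z \<in> D \<Longrightarrow> (F has_derivative (\<lambda>v. A z * Re v + B z * Im v)) (at z)"
      by blast
    have "((\<lambda>p. F (f p)) has_derivative (\<lambda>v. P p * Re v + Q p * Im v)) (at p)" if p: "p \<in> S" for p
    proof -
      have fp: "f p \<in> D" "g (f p) = p" using fg[OF p] by (auto simp: D_def)
      have f1: "(f has_derivative (\<lambda>v. deriv f p * v)) (at p)"
        using holomorphic_derivI[OF f S(1) p] by (simp add: has_field_derivative_def)
      \<comment> \<open>Differentiating \<open>g (f x) = x\<close> shows that pulling back along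
        \<open>f\<close> undoes the pullback along \<open>g\<close>.\<close>
      have "((\<lambda>x. g (f x)) has_derivative (\<lambda>v. g' (f p) * (deriv f p * v))) (at p)"
        by (rule has_derivative_compose[OF f1 g1[OF fp(1)]])
      moreover have "((\<lambda>x. g (f x)) has_derivative (\<lambda>v. v)) (at p)"
        using fg by (intro has_derivative_transform_within_open[OF has_derivative_ident S(1) p]) auto
      ultimately have "(\<lambda>v. g' (f p) * (deriv f p * v)) = (\<lambda>v. v)"
        by (rule has_derivative_unique)
      then have inv: "g' (f p) * (deriv f p * v) = v" for v by metis
      have "A (f p) * Re (deriv f p * v) + B (f p) * Im (deriv f p * v)
        = P p * Re (g' (f p) * (deriv f p * v)) + Q p * Im (g' (f p) * (deriv f p * v))" for v
        unfolding A_def B_def fp by (simp add: algebra_simps)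
      then show ?thesis
        using has_derivative_compose[OF f1 F[OF fp(1)]] by (simp only: inv)
    qed
    then show ?thesis by blast
  qed simp
qed

lemma linear_real_prod_expand:
  fixes f :: "real \<times> real \<Rightarrow> 'b::real_normed_vector"
  assumes "linear f"
  shows "f v = fst v *\<^sub>R f (1, 0) + snd v *\<^sub>R f (0, 1)"
proof -
  have "v = fst v *\<^sub>R (1, 0) + snd v *\<^sub>R (0, 1)" by (simp add: prod_eq_iff)
  then have "f v = f (fst v *\<^sub>R (1, 0) + snd v *\<^sub>R (0, 1))" by simp
  then show ?thesis by (simp only: linear_add[OF assms] linear_cmul[OF assms])
qed

lemma closed_form_exact:
  fixes P Q :: "real \<times> real \<Rightarrow> real"
  assumes S: "open S" "simply_connected S"
    and P: "\<And>p. p \<in> S \<Longrightarrow> (P has_derivative P' p) (at p)"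
    and Q: "\<And>p. p \<in> S \<Longrightarrow> (Q has_derivative Q' p) (at p)"
    and cont: "\<And>v. continuous_on S (\<lambda>p. P' p v)" "\<And>v. continuous_on S (\<lambda>p. Q' p v)"
    and closed: "\<And>p. p \<in> S \<Longrightarrow> P' p (0, 1) = Q' p (1, 0)"
  shows "\<exists>F. \<forall>p\<in>S. (F has_derivative (\<lambda>v. P p * fst v + Q p * snd v)) (at p)"
proof -
  define k where "k = (\<lambda>z. (Re z, Im z))"
  define j where "j = (\<lambda>p. Complex (fst p) (snd p))"
  have kj [simp]: "k (j p) = p" "j (k z) = z" for p z by (auto simp: k_def j_def complex_eq_iff)
  have bk: "(k has_derivative k) F" for F
    unfolding k_def by (intro bounded_linear_imp_has_derivative bounded_linear_Pair bounded_linear_Re bounded_linear_Im)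
  have jform: "j = (\<lambda>p. fst p *\<^sub>R 1 + snd p *\<^sub>R \<i>)" by (auto simp: j_def complex_eq_iff)
  have bj: "(j has_derivative j) F" for F
    unfolding jform by (auto intro!: derivative_eq_intros)
  have cj: "continuous_on X j" and ck: "continuous_on Y k" for X Y
    unfolding jform k_def by (intro continuous_intros)+
  define T where "T = k -` S"
  have T: "open T"
    unfolding T_def using continuous_on_open_vimage[of UNIV k] ck S(1) by auto
  have "j ` S = T" "k ` T = S"
    unfolding T_def by (auto simp: image_iff) (metis kj)+
  then have "S homeomorphic T"
    unfolding homeomorphic_def homeomorphism_def using cj ck by (intro exI[of _ j] exI[of _ k]) auto
  then have scT: "simply_connected T" using homeomorphic_simply_connected S(2) by blast
  have "\<exists>F. \<forall>z\<in>T. (F has_derivative (\<lambda>v. P (k z) * Re v + Q (k z) * Im v)) (at z)"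
  proof (rule closed_form_exact_complex[OF T scT, where P' = "\<lambda>z v. P' (k z) (k v)" and Q' = "\<lambda>z v. Q' (k z) (k v)"])
    fix z assume "z \<in> T" then have z: "k z \<in> S" by (simp add: T_def)
    show "((\<lambda>z. P (k z)) has_derivative (\<lambda>v. P' (k z) (k v))) (at z)"
      "((\<lambda>z. Q (k z)) has_derivative (\<lambda>v. Q' (k z) (k v))) (at z)"
      by (rule has_derivative_compose[OF bk P[OF z]] has_derivative_compose[OF bk Q[OF z]])+
    show "P' (k z) (k \<i>) = Q' (k z) (k 1)" using closed[OF z] by (simp add: k_def)
  next
    fix v
    show "continuous_on T (\<lambda>z. P' (k z) (k v))" "continuous_on T (\<lambda>z. Q' (k z) (k v))"
      by (rule continuous_on_compose2[OF cont(1) ck] continuous_on_compose2[OF cont(2) ck]; auto simp: T_def)+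
  qed
  then obtain F where F: "\<And>z. z \<in> T \<Longrightarrow> (F has_derivative (\<lambda>v. P (k z) * Re v + Q (k z) * Im v)) (at z)"
    by blast
  have "((\<lambda>p. F (j p)) has_derivative (\<lambda>v. P p * fst v + Q p * snd v)) (at p)" if "p \<in> S" for p
    using has_derivative_compose[OF bj F[of "j p"]] that by (simp add: T_def) (simp add: j_def)
  then show ?thesis by blast
qed

section \<open>Derivatives along coordinates\<close>

lemma smooth_on_imp_continuous_on: "smooth_on S f \<Longrightarrow> continuous_on S f"
  unfolding smooth_on_def by (metis Ck_on.simps(1))

lemma smooth_on_imp_linear: "smooth_on S f \<Longrightarrow> p \<in> S \<Longrightarrow> linear (frechet_derivative f (at p))"
  using smooth_on_has_derivative has_derivative_linear by blast

lemma frechet_derivative_frechet_symmetric: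
  fixes f :: "'a::real_normed_vector \<Rightarrow> 'b::real_inner"
  assumes "open S" "smooth_on S f" "p \<in> S"
  shows "frechet_derivative (\<lambda>q. frechet_derivative f (at q) v) (at p) w =
    frechet_derivative (\<lambda>q. frechet_derivative f (at q) w) (at p) v"
  by (rule second_derivative_symmetric[OF assms(1,3), where f' = "\<lambda>q. frechet_derivative f (at q)"])
     (rule smooth_on_has_derivative smooth_on_frechet_derivative assms | assumption)+

text \<open>Product rule for the differential applied to a moving vector: one term freezes the
  vector at \<open>U p\<close>, the other differentiates it. In terms of the partial derivatives
  \<open>fa\<close> and \<open>fb\<close> it is a rule for products of functions.\<close>

lemma has_derivative_frechet_derivative_apply:
  fixes f :: "real \<times> real \<Rightarrow> 'b::real_normed_vector"
  assumes S: "open S" "smooth_on S f" "p \<in> S"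
    and U: "(U has_derivative U') (at p)"
  shows "((\<lambda>q. frechet_derivative f (at q) (U q)) has_derivative
    (\<lambda>w. frechet_derivative (\<lambda>q. frechet_derivative f (at q) (U p)) (at p) w
      + frechet_derivative f (at p) (U' w))) (at p)"
proof -
  define fa where "fa q = frechet_derivative f (at q) (1, 0)" for q
  define fb where "fb q = frechet_derivative f (at q) (0, 1)" for q
  have f: "frechet_derivative f (at q) v = fst v *\<^sub>R fa q + snd v *\<^sub>R fb q" if "q \<in> S" for q v
    unfolding fa_def fb_def by (rule linear_real_prod_expand[OF smooth_on_imp_linear[OF S(2) that]])
  have fab: "(fa has_derivative frechet_derivative fa (at p)) (at p)"
    "(fb has_derivative frechet_derivative fb (at p)) (at p)"
    unfolding fa_def fb_def using S by (auto intro!: smooth_on_has_derivative smooth_on_frechet_derivative)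
  have 1: "((\<lambda>q. frechet_derivative f (at q) (U p)) has_derivative
      (\<lambda>w. fst (U p) *\<^sub>R frechet_derivative fa (at p) w + snd (U p) *\<^sub>R frechet_derivative fb (at p) w)) (at p)"
    by (rule has_derivative_transform_within_open[OF _ S(1,3)]) (auto intro!: derivative_eq_intros fab simp: f)
  have "((\<lambda>q. frechet_derivative f (at q) (U q)) has_derivative
      (\<lambda>w. (fst (U p) *\<^sub>R frechet_derivative fa (at p) w + fst (U' w) *\<^sub>R fa p)
        + (snd (U p) *\<^sub>R frechet_derivative fb (at p) w + snd (U' w) *\<^sub>R fb p))) (at p)"
    by (rule has_derivative_transform_within_open[OF _ S(1,3)]) (auto intro!: derivative_eq_intros fab U simp: f)
  then show ?thesis
    by (rule has_derivative_eq_rhs) (simp add: fun_eq_iff frechet_derivativeI[OF 1] f[OF S(3)])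
qed

section \<open>Linear maps of the plane and coordinate vector fields\<close>

lemma bij_real_prod_det:
  fixes L :: "real \<times> real \<Rightarrow> real \<times> real"
  assumes L: "linear L" and det: "fst (L (1, 0)) * snd (L (0, 1)) - fst (L (0, 1)) * snd (L (1, 0)) \<noteq> 0"
  shows "bij L"
proof -
  have "v = 0" if "L v = 0" for v
  proof -
    have "fst v * fst (L (1, 0)) + snd v * fst (L (0, 1)) = 0"
      "fst v * snd (L (1, 0)) + snd v * snd (L (0, 1)) = 0"
      using linear_real_prod_expand[OF L, of v] that by (auto simp: prod_eq_iff)
    then have "fst v * (fst (L (1, 0)) * snd (L (0, 1)) - fst (L (0, 1)) * snd (L (1, 0))) = 0"
      "snd v * (fst (L (1, 0)) * snd (L (0, 1)) - fst (L (0, 1)) * snd (L (1, 0))) = 0"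
      by algebra+
    then show ?thesis using det by (simp add: prod_eq_iff)
  qed
  then have "inj L" using linear_injective_0[OF L] by blast
  then show ?thesis using linear_injective_imp_surjective[OF L] by (simp add: bij_def)
qed

lemma bij_real_prod_imp_det:
  fixes L :: "real \<times> real \<Rightarrow> real \<times> real"
  assumes L: "linear L" and "bij L"
  shows "fst (L (1, 0)) * snd (L (0, 1)) - fst (L (0, 1)) * snd (L (1, 0)) \<noteq> 0" (is "?d \<noteq> 0")
proof
  assume d: "?d = 0"
  define x y where "x = L (1, 0)" and "y = L (0, 1)"
  have L': "L (s, t) = (s * fst x + t * fst y, s * snd x + t * snd y)" for s t
    using linear_real_prod_expand[OF L, of "(s, t)"] by (simp add: x_def y_def prod_eq_iff)
  have d': "fst x * snd y = fst y * snd x" using d by (simp add: x_def y_def)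
  have inj0: "v = (0, 0)" if "L v = (0, 0)" for v
  proof (rule injD[OF bij_is_inj[OF \<open>bij L\<close>]])
    show "L v = L (0, 0)" using that L'[of 0 0] by simp
  qed
  \<comment> \<open>Up to sign these arguments are the columns of the adjugate matrix, which
    \<open>L\<close> maps to multiples of the determinant. Injectivity then makes every entry of
    \<open>L\<close> zero.\<close>
  have "L (snd y, - snd x) = (0, 0)" "L (fst y, - fst x) = (0, 0)"
    unfolding L' using d' by (simp_all add: mult.commute)
  then have "(snd y, - snd x) = (0, 0)" "(fst y, - fst x) = (0, 0)" by (blast dest: inj0)+
  then have "L (1, 0) = (0, 0)" by (simp add: L')
  then show False using inj0[of "(1, 0)"] by simp
qed

text \<open>Cramer's rule; the explicit quotient makes the coordinate field differentiable in the
  base point.\<close>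

lemma inv_real_prod:
  fixes L :: "real \<times> real \<Rightarrow> real \<times> real"
  assumes L: "linear L" and "bij L"
  defines "d \<equiv> fst (L (1, 0)) * snd (L (0, 1)) - fst (L (0, 1)) * snd (L (1, 0))"
  shows "inv L c = ((fst c * snd (L (0, 1)) - snd c * fst (L (0, 1))) / d,
    (snd c * fst (L (1, 0)) - fst c * snd (L (1, 0))) / d)" (is "_ = ?v")
proof -
  have "d \<noteq> 0" unfolding d_def by (rule bij_real_prod_imp_det[OF assms(1,2)])
  then have "L ?v = c"
    unfolding linear_real_prod_expand[OF L, of ?v]
    by (auto simp: prod_eq_iff field_simps) (simp_all add: d_def algebra_simps)
  then show ?thesis using assms(2) by (metis bij_is_inj inv_f_f)
qed

text \<open>The coordinate field \<open>V\<close> satisfies dz(V) = c. Differentiating this identity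
  gives the derivative of \<open>V\<close> as minus the inverse of dz applied to the second
  derivative of \<open>z\<close>, and the product rule finishes.\<close>

lemma has_derivative_coord_deriv:
  fixes f :: "real \<times> real \<Rightarrow> 'b::real_normed_vector" and c :: paracomplex
  assumes S: "open S" "p \<in> S" and z: "coordinate_on S z" and f: "smooth_on S f"
  defines "U \<equiv> inv (frechet_derivative z (at p)) c"
  shows "(coord_deriv z c f has_derivative
    (\<lambda>w. frechet_derivative (\<lambda>q. frechet_derivative f (at q) U) (at p) w -
      frechet_derivative f (at p) (inv (frechet_derivative z (at p))
        (frechet_derivative (\<lambda>q. frechet_derivative z (at q) U) (at p) w)))) (at p)"
proof -
  have bz: "bij (frechet_derivative z (at q))" if "q \<in> S" for q
    using z that by (auto simp: coordinate_on_def)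
  have sz: "smooth_on S z" using z by (simp add: coordinate_on_def)
  define za where "za q = frechet_derivative z (at q) (1, 0)" for q
  define zb where "zb q = frechet_derivative z (at q) (0, 1)" for q
  define V where "V q = inv (frechet_derivative z (at q)) c" for q
  define d where "d q = fst (za q) * snd (zb q) - fst (zb q) * snd (za q)" for q
  have d0: "d q \<noteq> 0" if "q \<in> S" for q
    unfolding d_def za_def zb_def by (rule bij_real_prod_imp_det[OF smooth_on_imp_linear[OF sz that] bz[OF that]])
  have zab: "(za has_derivative frechet_derivative za (at p)) (at p)"
    "(zb has_derivative frechet_derivative zb (at p)) (at p)"
    unfolding za_def zb_def using S by (auto intro!: smooth_on_has_derivative smooth_on_frechet_derivative sz)
  \<comment> \<open>Only existence of the derivative is taken from Cramer's rule; its value follows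
    below from the constancy of dz(V).\<close>
  have "\<exists>V0. ((\<lambda>q. ((fst c * snd (zb q) - snd c * fst (zb q)) / d q,
      (snd c * fst (za q) - fst c * snd (za q)) / d q)) has_derivative V0) (at p)"
    unfolding d_def
    by (rule exI, (rule has_derivative_Pair has_derivative_divide' has_derivative_diff has_derivative_mult
        has_derivative_const has_derivative_fst has_derivative_snd zab d0[OF S(2), unfolded d_def])+)
  then obtain V0 where "((\<lambda>q. ((fst c * snd (zb q) - snd c * fst (zb q)) / d q,
      (snd c * fst (za q) - fst c * snd (za q)) / d q)) has_derivative V0) (at p)" ..
  then have V: "(V has_derivative V0) (at p)"
    by (rule has_derivative_transform_within_open[OF _ S])
       (simp add: V_def inv_real_prod[OF smooth_on_imp_linear[OF sz] bz] d_def za_def zb_def)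
  have const: "((\<lambda>q. frechet_derivative z (at q) (V q)) has_derivative (\<lambda>w. 0)) (at p)"
    by (rule has_derivative_transform_within_open[OF has_derivative_const S])
       (simp add: V_def bij_is_surj[OF bz] surj_f_inv_f)
  define Z where "Z = frechet_derivative z (at p)"
  define Z2 where "Z2 = frechet_derivative (\<lambda>q. frechet_derivative z (at q) U) (at p)"
  have Z: "linear Z" "bij Z" unfolding Z_def using smooth_on_imp_linear[OF sz S(2)] bz[OF S(2)] by auto
  have eq: "(\<lambda>w. Z2 w + Z (V0 w)) = (\<lambda>w. 0)"
    using has_derivative_unique[OF has_derivative_frechet_derivative_apply[OF S(1) sz S(2) V] const]
    by (simp add: Z_def Z2_def U_def V_def)
  have "Z (- V0 w) = Z2 w" for w
    unfolding linear_neg[OF Z(1)] using fun_cong[OF eq, of w] by (simp add: add_eq_0_iff)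
  then have "inv Z (Z2 w) = - V0 w" for w
    using inv_f_f[OF bij_is_inj[OF Z(2)], of "- V0 w"] by simp
  then have V0: "V0 w = - inv Z (Z2 w)" for w by simp
  have "coord_deriv z c f = (\<lambda>q. frechet_derivative f (at q) (V q))"
    by (simp add: fun_eq_iff coord_deriv_def V_def)
  then show ?thesis
    using has_derivative_frechet_derivative_apply[OF S(1) f S(2) V]
    by (simp add: V0 linear_neg[OF smooth_on_imp_linear[OF f S(2)]] U_def V_def Z_def Z2_def)
qed

text \<open>Both sides are the Hessian of \<open>f\<close> in the coordinate \<open>z\<close>: the
  second derivative of \<open>f\<close> on \<open>U c\<close> and \<open>U d\<close>, corrected by
  that of \<open>z\<close> on the same pair. Both second derivatives are symmetric.\<close>

lemma coord_deriv_commute: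
  fixes f :: "real \<times> real \<Rightarrow> 'b::real_inner"
  assumes S: "open S" "p \<in> S" and z: "coordinate_on S z" and f: "smooth_on S f"
  shows "coord_deriv z c (coord_deriv z d f) p = coord_deriv z d (coord_deriv z c f) p"
proof -
  have sz: "smooth_on S z" using z by (simp add: coordinate_on_def)
  define U where "U = inv (frechet_derivative z (at p))"
  show ?thesis
    unfolding coord_deriv_def[of z c "coord_deriv z d f"] coord_deriv_def[of z d "coord_deriv z c f"]
      frechet_derivativeI[OF has_derivative_coord_deriv[OF S z f]] U_def[symmetric]
    by (simp only: frechet_derivative_frechet_symmetric[OF S(1) f S(2), of "U d" "U c"]
        frechet_derivative_frechet_symmetric[OF S(1) sz S(2), of "U d" "U c"])
qed

section \<open>The Hodge star of the differential of a timelike minimal immersion\<close>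

lemma mink_commute: "mink x y = mink y x"
  by (simp add: mink_def)

lemma bounded_bilinear_mink: "bounded_bilinear mink"
proof -
  have "bounded_bilinear (\<lambda>x y :: minkowski3. (fst x, fst (snd x), - snd (snd x)) \<bullet> y)"
    by (rule bounded_bilinear.comp1[OF bounded_bilinear_inner])
       (intro bounded_linear_Pair bounded_linear_minus bounded_linear_fst bounded_linear_fst_comp
         bounded_linear_snd_comp bounded_linear_ident)+
  moreover have "(\<lambda>x y :: minkowski3. (fst x, fst (snd x), - snd (snd x)) \<bullet> y) = mink"
    by (auto simp: fun_eq_iff mink_def inner_prod_def)
  ultimately show ?thesis by simp
qed

lemma mink_linear:
  "mink (x + y) w = mink x w + mink y w" "mink w (x + y) = mink w x + mink w y"
  "mink (x - y) w = mink x w - mink y w" "mink w (x - y) = mink w x - mink w y"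
  "mink (c *\<^sub>R x) w = c * mink x w" "mink w (c *\<^sub>R x) = c * mink w x"
  "mink 0 w = 0" "mink w 0 = 0" "mink (- x) w = - mink x w" "mink w (- x) = - mink w x"
  by (simp_all add: mink_def algebra_simps)

text \<open>The Euclidean cross product with its time component negated, so that
  \<open>mink w (mink_cross x y)\<close> is the determinant of \<open>w\<close>, \<open>x\<close>,
  \<open>y\<close>.\<close>

definition mink_cross :: "minkowski3 \<Rightarrow> minkowski3 \<Rightarrow> minkowski3" where
  "mink_cross x y = (fst (snd x) * snd (snd y) - snd (snd x) * fst (snd y),
     snd (snd x) * fst y - fst x * snd (snd y), fst (snd x) * fst y - fst x * fst (snd y))"

lemma mink_cross_orthogonal: "mink x (mink_cross x y) = 0" "mink y (mink_cross x y) = 0"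
  by (simp_all add: mink_def mink_cross_def algebra_simps)

text \<open>Lagrange's identity, with the sign opposite to the Euclidean one: the normal of a
  timelike plane is spacelike.\<close>

lemma mink_cross_self:
  "mink (mink_cross x y) (mink_cross x y) = (mink x y)\<^sup>2 - mink x x * mink y y"
  by (simp add: mink_def mink_cross_def algebra_simps power2_eq_square)

lemma mink_nondegenerate:
  assumes "mink v x = 0" "mink v y = 0" "mink v (mink_cross x y) = 0"
    and "mink x x * mink y y \<noteq> (mink x y)\<^sup>2"
  shows "v = 0"
proof -
  \<comment> \<open>The expansion of \<open>v\<close> in the basis \<open>x\<close>, \<open>y\<close>, \<open>mink_cross x y\<close>, cleared of denominators.\<close>
  have "((mink x y)\<^sup>2 - mink x x * mink y y) *\<^sub>R v = mink v (mink_cross x y) *\<^sub>R mink_cross x y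
      - (mink y y * mink v x - mink x y * mink v y) *\<^sub>R x
      - (mink x x * mink v y - mink x y * mink v x) *\<^sub>R y"
    by (simp add: prod_eq_iff mink_def mink_cross_def algebra_simps power2_eq_square)
  then show ?thesis using assms by simp
qed

section \<open>Metric coefficients, mean curvature and the star form in the given
  coordinates\<close>

locale timelike_minimal_immersion =
  fixes \<Omega> :: "paracomplex set" and \<psi> :: "paracomplex \<Rightarrow> minkowski3"
  assumes open_domain: "open \<Omega>"
    and timelike: "timelike_immersion \<Omega> \<psi>"
    and minimal: "minimal_on \<Omega> \<psi>"
begin

definition \<psi>a where "\<psi>a p = frechet_derivative \<psi> (at p) (1, 0)"
definition \<psi>b where "\<psi>b p = frechet_derivative \<psi> (at p) (0, 1)"
definition gE where "gE p = mink (\<psi>a p) (\<psi>a p)"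
definition gF where "gF p = mink (\<psi>a p) (\<psi>b p)"
definition gG where "gG p = mink (\<psi>b p) (\<psi>b p)"
text \<open>Minus the Gram determinant, hence positive in signature (1,1); its root
  \<open>gW\<close> is the area density.\<close>

definition gD where "gD p = (gF p)\<^sup>2 - gE p * gG p"
definition gW where "gW p = sqrt (gD p)"

text \<open>The \<open>minkowski3\<close>-valued 1-form \<open>*d\<psi>\<close>, where \<open>*\<close> is the Hodge star of the induced metric.\<close>

definition \<omega>a where "\<omega>a p = inverse (gW p) *\<^sub>R (gF p *\<^sub>R \<psi>a p - gE p *\<^sub>R \<psi>b p)"
definition \<omega>b where "\<omega>b p = inverse (gW p) *\<^sub>R (gG p *\<^sub>R \<psi>a p - gF p *\<^sub>R \<psi>b p)"

lemma smooth: "smooth_on \<Omega> \<psi>"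
  using timelike by (simp add: timelike_immersion_def immersion_on_def)

lemma frechet_derivative_\<psi>:
  "p \<in> \<Omega> \<Longrightarrow> frechet_derivative \<psi> (at p) v = fst v *\<^sub>R \<psi>a p + snd v *\<^sub>R \<psi>b p"
  unfolding \<psi>a_def \<psi>b_def by (rule linear_real_prod_expand[OF smooth_on_imp_linear[OF smooth]])

lemma first_form_eq:
  "p \<in> \<Omega> \<Longrightarrow> first_form \<psi> p v w = fst v * fst w * gE p
    + (fst v * snd w + snd v * fst w) * gF p + snd v * snd w * gG p"
  unfolding first_form_def frechet_derivative_\<psi> gE_def gF_def gG_def
  by (simp add: mink_linear mink_commute[of "\<psi>b p" "\<psi>a p"] algebra_simps)

text \<open>Gram determinants in two bases differ by the square of the determinant of the change of
  basis, and in the basis \<open>e\<close>, \<open>f\<close> the value is -1.\<close>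

lemma gD_pos:
  assumes p: "p \<in> \<Omega>"
  shows "gD p > 0"
proof -
  obtain e f where ef: "first_form \<psi> p e e = 1" "first_form \<psi> p f f = - 1" "first_form \<psi> p e f = 0"
    using timelike p unfolding timelike_immersion_def lorentzian_form_def by blast
  have "(first_form \<psi> p e f)\<^sup>2 - first_form \<psi> p e e * first_form \<psi> p f f
      = (fst e * snd f - snd e * fst f)\<^sup>2 * gD p"
    unfolding first_form_eq[OF p] gD_def by (simp add: algebra_simps power2_eq_square)
  then have "(fst e * snd f - snd e * fst f)\<^sup>2 * gD p = 1" using ef by simp
  then show ?thesis
    by (metis zero_less_mult_pos zero_less_one zero_less_power2 mult_zero_left zero_eq_power2 zero_neq_one)
qed

lemma gW: "p \<in> \<Omega> \<Longrightarrow> gW p > 0" "p \<in> \<Omega> \<Longrightarrow> gW p * gW p = gD p"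
  unfolding gW_def using gD_pos[of p] by auto

lemma smooth_components:
  "smooth_on \<Omega> \<psi>a" "smooth_on \<Omega> \<psi>b" "smooth_on \<Omega> gE" "smooth_on \<Omega> gF" "smooth_on \<Omega> gG"
  "smooth_on \<Omega> gW" "smooth_on \<Omega> \<omega>a" "smooth_on \<Omega> \<omega>b"
proof -
  note bil = smooth_on_bilinear[OF open_domain]
  show ab: "smooth_on \<Omega> \<psi>a" "smooth_on \<Omega> \<psi>b"
    unfolding \<psi>a_def \<psi>b_def by (intro smooth_on_frechet_derivative smooth)+
  show EFG: "smooth_on \<Omega> gE" "smooth_on \<Omega> gF" "smooth_on \<Omega> gG"
    unfolding gE_def gF_def gG_def by (intro bil[OF bounded_bilinear_mink] ab)+
  have "smooth_on \<Omega> gD"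
    unfolding gD_def power2_eq_square
    by (intro smooth_on_diff[OF open_domain] bil[OF bounded_bilinear_mult] EFG)
  then show W: "smooth_on \<Omega> gW"
    unfolding gW_def by (rule smooth_on_sqrt[OF open_domain]) (rule gD_pos)
  show "smooth_on \<Omega> \<omega>a" "smooth_on \<Omega> \<omega>b"
    unfolding \<omega>a_def \<omega>b_def
    by (intro bil[OF bounded_bilinear_scaleR] smooth_on_diff[OF open_domain]
        smooth_on_inverse[OF open_domain] W EFG ab gW(1); assumption)+
qed

text \<open>The vanishing trace, cleared of the Gram determinant and of the factor that normalises
  the cross product to the unit normal \<open>N\<close>.\<close>

lemma minimal_normal:
  assumes p: "p \<in> \<Omega>"
  shows "mink (gG p *\<^sub>R frechet_derivative \<psi>a (at p) (1, 0) - (2 * gF p) *\<^sub>R frechet_derivative \<psi>a (at p) (0, 1)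
    + gE p *\<^sub>R frechet_derivative \<psi>b (at p) (0, 1)) (mink_cross (\<psi>a p) (\<psi>b p)) = 0"
proof -
  define C where "C = mink_cross (\<psi>a p) (\<psi>b p)"
  define N where "N = inverse (gW p) *\<^sub>R C"
  have CC: "mink C C = gD p" unfolding C_def mink_cross_self gD_def gE_def gF_def gG_def ..
  have "mink N N = inverse (gW p) * inverse (gW p) * (gW p * gW p)"
    unfolding N_def mink_linear CC gW(2)[OF p] by simp
  also have "\<dots> = 1" using gW(1)[OF p] by (simp add: field_simps)
  finally have "unit_normal \<psi> p N"
    unfolding unit_normal_def frechet_derivative_\<psi>[OF p] N_def C_def mink_linear mink_cross_orthogonal by simp
  then have "mean_curvature \<psi> N p = 0" using minimal p unfolding minimal_on_def by blast
  moreover have "frechet_derivative \<psi>b (at p) (1, 0) = frechet_derivative \<psi>a (at p) (0, 1)"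
    unfolding \<psi>a_def \<psi>b_def by (rule frechet_derivative_frechet_symmetric[OF open_domain smooth p])
  moreover have "gE p * gG p - gF p * gF p \<noteq> 0"
    using gD_pos[OF p] by (auto simp: gD_def power2_eq_square)
  ultimately have "gG p * mink (frechet_derivative \<psi>a (at p) (1, 0)) N
      - gF p * mink (frechet_derivative \<psi>a (at p) (0, 1)) N - gF p * mink (frechet_derivative \<psi>a (at p) (0, 1)) N
      + gE p * mink (frechet_derivative \<psi>b (at p) (0, 1)) N = 0"
    by (simp add: mean_curvature_def form_trace_def Let_def first_form_eq[OF p] second_form_def
        flip: \<psi>a_def \<psi>b_def)
  then have "inverse (gW p) * mink (gG p *\<^sub>R frechet_derivative \<psi>a (at p) (1, 0)
      - (2 * gF p) *\<^sub>R frechet_derivative \<psi>a (at p) (0, 1) + gE p *\<^sub>R frechet_derivative \<psi>b (at p) (0, 1)) C = 0"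
    unfolding N_def by (simp add: mink_linear algebra_simps)
  then show ?thesis using gW(1)[OF p] by (simp add: C_def)
qed

lemma frechet_derivative_mink:
  assumes "smooth_on \<Omega> f" "smooth_on \<Omega> g" "p \<in> \<Omega>"
  shows "frechet_derivative (\<lambda>q. mink (f q) (g q)) (at p) v =
    mink (f p) (frechet_derivative g (at p) v) + mink (frechet_derivative f (at p) v) (g p)"
  using frechet_derivativeI[OF bounded_bilinear.FDERIV[OF bounded_bilinear_mink
      smooth_on_has_derivative[OF assms(1,3)] smooth_on_has_derivative[OF assms(2,3)]]] by simp

text \<open>The difference of the two sides is \<open>gW p\<close> times the Laplacian of \<psi> for
  the induced metric.\<close>

lemma closed_\<omega>:
  assumes p: "p \<in> \<Omega>"
  shows "frechet_derivative \<omega>a (at p) (0, 1) = frechet_derivative \<omega>b (at p) (1, 0)"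
proof -
  note sm = smooth_components
  define A B where "A = \<psi>a p" and "B = \<psi>b p"
  define AA AB BB where "AA = frechet_derivative \<psi>a (at p) (1, 0)"
    and "AB = frechet_derivative \<psi>a (at p) (0, 1)" and "BB = frechet_derivative \<psi>b (at p) (0, 1)"
  have BA: "frechet_derivative \<psi>b (at p) (1, 0) = AB"
    unfolding AB_def \<psi>a_def \<psi>b_def by (rule frechet_derivative_frechet_symmetric[OF open_domain smooth p])
  define E F G W D where "E = gE p" and "F = gF p" and "G = gG p" and "W = gW p" and "D = gD p"
  define Fa Fb Eb Ga Wa Wb where "Fa = frechet_derivative gF (at p) (1, 0)"
    and "Fb = frechet_derivative gF (at p) (0, 1)" and "Eb = frechet_derivative gE (at p) (0, 1)"
    and "Ga = frechet_derivative gG (at p) (1, 0)"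
    and "Wa = frechet_derivative gW (at p) (1, 0)" and "Wb = frechet_derivative gW (at p) (0, 1)"
  define Ea Gb where "Ea = frechet_derivative gE (at p) (1, 0)" and "Gb = frechet_derivative gG (at p) (0, 1)"
  have dE: "frechet_derivative gE (at p) v = 2 * mink A (frechet_derivative \<psi>a (at p) v)" for v
    unfolding gE_def A_def frechet_derivative_mink[OF sm(1,1) p] by (simp add: mink_commute)
  have dG: "frechet_derivative gG (at p) v = 2 * mink B (frechet_derivative \<psi>b (at p) v)" for v
    unfolding gG_def B_def frechet_derivative_mink[OF sm(2,2) p] by (simp add: mink_commute)
  have dF: "frechet_derivative gF (at p) v = mink A (frechet_derivative \<psi>b (at p) v)
      + mink B (frechet_derivative \<psi>a (at p) v)" for v
    unfolding gF_def A_def B_def frechet_derivative_mink[OF sm(1,2) p] by (simp add: mink_commute)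
  \<comment> \<open>These are the Christoffel symbols of the first kind: tangential parts of second
    derivatives are determined by the metric alone.\<close>
  have prods: "mink AA A = Ea / 2" "mink AA B = Fa - Eb / 2" "mink AB A = Eb / 2" "mink AB B = Ga / 2"
    "mink BB A = Fb - Ga / 2" "mink BB B = Gb / 2"
    unfolding Ea_def Fa_def Eb_def Ga_def Fb_def Gb_def dE dF dG BA AA_def[symmetric] AB_def[symmetric] BB_def[symmetric]
    by (simp_all add: mink_commute)
  have AB': "mink A A = E" "mink A B = F" "mink B A = F" "mink B B = G"
    unfolding A_def B_def E_def F_def G_def gE_def gF_def gG_def by (simp_all add: mink_commute)
  note der = sm(1-8)[THEN smooth_on_has_derivative, OF p]
  \<comment> \<open>Differentiating the square of \<open>gW\<close>, and below the products of
    \<open>gW\<close> with the star form, keeps every identity polynomial.\<close>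
  have dW: "2 * (W * frechet_derivative gW (at p) v) = 2 * (F * frechet_derivative gF (at p) v)
      - (E * frechet_derivative gG (at p) v + frechet_derivative gE (at p) v * G)" for v
  proof -
    have 1: "((\<lambda>q. gW q * gW q) has_derivative
        (\<lambda>v. gW p * frechet_derivative gW (at p) v + frechet_derivative gW (at p) v * gW p)) (at p)"
      by (intro has_derivative_mult der)
    have "((\<lambda>q. gF q * gF q - gE q * gG q) has_derivative
        (\<lambda>v. (gF p * frechet_derivative gF (at p) v + frechet_derivative gF (at p) v * gF p) -
          (gE p * frechet_derivative gG (at p) v + frechet_derivative gE (at p) v * gG p))) (at p)"
      by (intro has_derivative_mult has_derivative_diff der)
    then have 2: "((\<lambda>q. gW q * gW q) has_derivative
        (\<lambda>v. (gF p * frechet_derivative gF (at p) v + frechet_derivative gF (at p) v * gF p) -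
          (gE p * frechet_derivative gG (at p) v + frechet_derivative gE (at p) v * gG p))) (at p)"
      by (rule has_derivative_transform_within_open[OF _ open_domain p]) (simp add: gW gD_def power2_eq_square)
    show ?thesis
      using fun_cong[OF has_derivative_unique[OF 1 2], of v]
      unfolding E_def F_def G_def W_def by (simp add: algebra_simps)
  qed
  have Oa: "W *\<^sub>R frechet_derivative \<omega>a (at p) v + frechet_derivative gW (at p) v *\<^sub>R \<omega>a p =
      F *\<^sub>R frechet_derivative \<psi>a (at p) v + frechet_derivative gF (at p) v *\<^sub>R A
      - (E *\<^sub>R frechet_derivative \<psi>b (at p) v + frechet_derivative gE (at p) v *\<^sub>R B)" for v
  proof -
    have 1: "((\<lambda>q. gW q *\<^sub>R \<omega>a q) has_derivative
        (\<lambda>v. gW p *\<^sub>R frechet_derivative \<omega>a (at p) v + frechet_derivative gW (at p) v *\<^sub>R \<omega>a p)) (at p)"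
      by (intro has_derivative_scaleR der)
    have "((\<lambda>q. gF q *\<^sub>R \<psi>a q - gE q *\<^sub>R \<psi>b q) has_derivative
        (\<lambda>v. (gF p *\<^sub>R frechet_derivative \<psi>a (at p) v + frechet_derivative gF (at p) v *\<^sub>R \<psi>a p) -
          (gE p *\<^sub>R frechet_derivative \<psi>b (at p) v + frechet_derivative gE (at p) v *\<^sub>R \<psi>b p))) (at p)"
      by (intro has_derivative_scaleR has_derivative_diff der)
    then have 2: "((\<lambda>q. gW q *\<^sub>R \<omega>a q) has_derivative
        (\<lambda>v. (gF p *\<^sub>R frechet_derivative \<psi>a (at p) v + frechet_derivative gF (at p) v *\<^sub>R \<psi>a p) -
          (gE p *\<^sub>R frechet_derivative \<psi>b (at p) v + frechet_derivative gE (at p) v *\<^sub>R \<psi>b p))) (at p)"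
      by (rule has_derivative_transform_within_open[OF _ open_domain p]) (use gW(1) in \<open>force simp: \<omega>a_def\<close>)
    show ?thesis
      using fun_cong[OF has_derivative_unique[OF 1 2], of v]
      unfolding E_def F_def W_def A_def B_def by simp
  qed
  have Ob: "W *\<^sub>R frechet_derivative \<omega>b (at p) v + frechet_derivative gW (at p) v *\<^sub>R \<omega>b p =
      G *\<^sub>R frechet_derivative \<psi>a (at p) v + frechet_derivative gG (at p) v *\<^sub>R A
      - (F *\<^sub>R frechet_derivative \<psi>b (at p) v + frechet_derivative gF (at p) v *\<^sub>R B)" for v
  proof -
    have 1: "((\<lambda>q. gW q *\<^sub>R \<omega>b q) has_derivative
        (\<lambda>v. gW p *\<^sub>R frechet_derivative \<omega>b (at p) v + frechet_derivative gW (at p) v *\<^sub>R \<omega>b p)) (at p)"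
      by (intro has_derivative_scaleR der)
    have "((\<lambda>q. gG q *\<^sub>R \<psi>a q - gF q *\<^sub>R \<psi>b q) has_derivative
        (\<lambda>v. (gG p *\<^sub>R frechet_derivative \<psi>a (at p) v + frechet_derivative gG (at p) v *\<^sub>R \<psi>a p) -
          (gF p *\<^sub>R frechet_derivative \<psi>b (at p) v + frechet_derivative gF (at p) v *\<^sub>R \<psi>b p))) (at p)"
      by (intro has_derivative_scaleR has_derivative_diff der)
    then have 2: "((\<lambda>q. gW q *\<^sub>R \<omega>b q) has_derivative
        (\<lambda>v. (gG p *\<^sub>R frechet_derivative \<psi>a (at p) v + frechet_derivative gG (at p) v *\<^sub>R \<psi>a p) -
          (gF p *\<^sub>R frechet_derivative \<psi>b (at p) v + frechet_derivative gF (at p) v *\<^sub>R \<psi>b p))) (at p)"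
      by (rule has_derivative_transform_within_open[OF _ open_domain p]) (use gW(1) in \<open>force simp: \<omega>b_def\<close>)
    show ?thesis
      using fun_cong[OF has_derivative_unique[OF 1 2], of v]
      unfolding G_def F_def W_def A_def B_def by simp
  qed
  have W0: "W > 0" "W * W = D" and D: "D = F * F - E * G" and D0: "D > 0"
    using gW[OF p] gD_pos[OF p] unfolding W_def D_def gD_def E_def F_def G_def by (auto simp: power2_eq_square)
  define R where "R = frechet_derivative \<omega>a (at p) (0, 1) - frechet_derivative \<omega>b (at p) (1, 0)"
  define M where "M = G *\<^sub>R AA - (2 * F) *\<^sub>R AB + E *\<^sub>R BB"
  have WR: "W *\<^sub>R R = (Fb - Ga) *\<^sub>R A + (Fa - Eb) *\<^sub>R B - M - Wb *\<^sub>R \<omega>a p + Wa *\<^sub>R \<omega>b p"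
  proof -
    have 1: "W *\<^sub>R frechet_derivative \<omega>a (at p) (0, 1) = F *\<^sub>R AB + Fb *\<^sub>R A - (E *\<^sub>R BB + Eb *\<^sub>R B) - Wb *\<^sub>R \<omega>a p"
      using Oa[of "(0, 1)"] unfolding AB_def BB_def Fb_def Eb_def Wb_def by (simp add: eq_diff_eq)
    have 2: "W *\<^sub>R frechet_derivative \<omega>b (at p) (1, 0) = G *\<^sub>R AA + Ga *\<^sub>R A - (F *\<^sub>R AB + Fa *\<^sub>R B) - Wa *\<^sub>R \<omega>b p"
      using Ob[of "(1, 0)"] unfolding BA AA_def Fa_def Ga_def Wa_def by (simp add: eq_diff_eq)
    show ?thesis
      unfolding R_def scaleR_diff_right 1 2 M_def by (simp add: algebra_simps scaleR_2[symmetric])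
  qed
  have \<omega>: "W *\<^sub>R \<omega>a p = F *\<^sub>R A - E *\<^sub>R B" "W *\<^sub>R \<omega>b p = G *\<^sub>R A - F *\<^sub>R B"
    using W0(1) unfolding \<omega>a_def \<omega>b_def W_def[symmetric] E_def F_def G_def A_def B_def by auto
  \<comment> \<open>\<open>V\<close> is \<open>2 D W R\<close>, freed of the square root \<open>W\<close>. Its tangential components vanish because of the
    formulas \<open>prods\<close> for any immersion, and its normal component is a multiple of the mean curvature.\<close>
  define V where "V = (2 * D) *\<^sub>R ((Fb - Ga) *\<^sub>R A + (Fa - Eb) *\<^sub>R B - M)
      - (2 * (W * Wb)) *\<^sub>R (F *\<^sub>R A - E *\<^sub>R B) + (2 * (W * Wa)) *\<^sub>R (G *\<^sub>R A - F *\<^sub>R B)"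
  have "V = (2 * D * W) *\<^sub>R R"
  proof -
    have "(2 * D * W) *\<^sub>R R = (2 * D) *\<^sub>R ((Fb - Ga) *\<^sub>R A + (Fa - Eb) *\<^sub>R B - M)
      - (2 * (W * W) * Wb) *\<^sub>R \<omega>a p + (2 * (W * W) * Wa) *\<^sub>R \<omega>b p"
      using arg_cong[OF WR, of "(*\<^sub>R) (2 * D)"] unfolding W0(2) by (simp add: algebra_simps)
    also have "(2 * (W * W) * Wb) *\<^sub>R \<omega>a p = (2 * (W * Wb)) *\<^sub>R (F *\<^sub>R A - E *\<^sub>R B)"
      unfolding \<omega>[symmetric] by (simp add: mult_ac)
    also have "(2 * (W * W) * Wa) *\<^sub>R \<omega>b p = (2 * (W * Wa)) *\<^sub>R (G *\<^sub>R A - F *\<^sub>R B)"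
      unfolding \<omega>[symmetric] by (simp add: mult_ac)
    finally show ?thesis by (simp add: V_def)
  qed
  moreover have "V = 0"
  proof (rule mink_nondegenerate)
    have Wab: "2 * (W * Wa) = 2 * (F * Fa) - (E * Ga + Ea * G)" "2 * (W * Wb) = 2 * (F * Fb) - (E * Gb + Eb * G)"
      using dW unfolding Wa_def Wb_def Fa_def Fb_def Ea_def Eb_def Ga_def Gb_def by auto
    show "mink V A = 0" "mink V B = 0"
      unfolding V_def Wab M_def D mink_linear prods AB' by algebra+
    show "mink A A * mink B B \<noteq> (mink A B)\<^sup>2"
      unfolding AB' using D D0 by (auto simp: power2_eq_square)
    have "mink M (mink_cross A B) = 0"
      using minimal_normal[OF p] unfolding M_def A_def B_def AA_def AB_def BB_def E_def F_def G_def .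
    then show "mink V (mink_cross A B) = 0"
      unfolding V_def mink_linear mink_cross_orthogonal by simp
  qed
  ultimately show ?thesis using W0(1) D0 by (simp add: R_def)
qed

lemma exact_\<omega>:
  assumes "simply_connected \<Omega>"
  obtains Y where "\<And>p. p \<in> \<Omega> \<Longrightarrow> (Y has_derivative (\<lambda>v. fst v *\<^sub>R \<omega>a p + snd v *\<^sub>R \<omega>b p)) (at p)"
    "smooth_on \<Omega> Y"
proof -
  note der = smooth_components(7,8)[THEN smooth_on_has_derivative]
  have ex: "\<exists>y. \<forall>p\<in>\<Omega>. (y has_derivative (\<lambda>v. c (\<omega>a p) * fst v + c (\<omega>b p) * snd v)) (at p)"
    if c: "bounded_linear c" for c :: "minkowski3 \<Rightarrow> real"
  proof (rule closed_form_exact[OF open_domain assms,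
      where P' = "\<lambda>p v. c (frechet_derivative \<omega>a (at p) v)" and Q' = "\<lambda>p v. c (frechet_derivative \<omega>b (at p) v)"])
    show "continuous_on \<Omega> (\<lambda>p. c (frechet_derivative \<omega>a (at p) v))"
      "continuous_on \<Omega> (\<lambda>p. c (frechet_derivative \<omega>b (at p) v))" for v
      by (intro smooth_on_imp_continuous_on smooth_on_linear[OF open_domain c] smooth_on_frechet_derivative smooth_components)+
  qed (auto intro: bounded_linear.has_derivative[OF c] der simp: closed_\<omega>)
  have bl: "bounded_linear (fst :: minkowski3 \<Rightarrow> real)" "bounded_linear (\<lambda>x::minkowski3. fst (snd x))"
    "bounded_linear (\<lambda>x::minkowski3. snd (snd x))"
    by (intro bounded_linear_fst bounded_linear_fst_comp bounded_linear_snd_comp bounded_linear_snd)+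
  obtain y1 y2 y3 where
    "\<And>p. p \<in> \<Omega> \<Longrightarrow> (y1 has_derivative (\<lambda>v. fst (\<omega>a p) * fst v + fst (\<omega>b p) * snd v)) (at p)"
    "\<And>p. p \<in> \<Omega> \<Longrightarrow> (y2 has_derivative (\<lambda>v. fst (snd (\<omega>a p)) * fst v + fst (snd (\<omega>b p)) * snd v)) (at p)"
    "\<And>p. p \<in> \<Omega> \<Longrightarrow> (y3 has_derivative (\<lambda>v. snd (snd (\<omega>a p)) * fst v + snd (snd (\<omega>b p)) * snd v)) (at p)"
    using ex[OF bl(1)] ex[OF bl(2)] ex[OF bl(3)] by blast
  from has_derivative_Pair[OF this(1) has_derivative_Pair[OF this(2,3)]]
  have Y: "((\<lambda>p. (y1 p, y2 p, y3 p)) has_derivative (\<lambda>v. fst v *\<^sub>R \<omega>a p + snd v *\<^sub>R \<omega>b p)) (at p)" if "p \<in> \<Omega>" for p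
    by (rule has_derivative_eq_rhs) (use that in \<open>auto simp: fun_eq_iff prod_eq_iff\<close>)
  moreover have "smooth_on \<Omega> (\<lambda>p. (y1 p, y2 p, y3 p))"
    by (rule smooth_onI[OF open_domain Y])
       (auto intro!: smooth_on_add[OF open_domain] smooth_on_linear[OF open_domain bounded_linear_scaleR_right] smooth_components)
  ultimately show thesis by (rule that)
qed

end

section \<open>Isothermal coordinates and the Enneper representation\<close>

lemma coord_deriv_eq:
  "(f has_derivative f') (at p) \<Longrightarrow> coord_deriv z c f p = f' (inv (frechet_derivative z (at p)) c)"
  by (simp add: coord_deriv_def frechet_derivativeI)

text \<open>Applied to the Jacobian of an isothermal coordinate, it gives one orientation sign on
  all of \<Omega>, so the conjugate map needs only one global sign.\<close>

lemma connected_nonzero_sgn_const: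
  fixes f :: "'a::topological_space \<Rightarrow> real"
  assumes "connected S" "continuous_on S f" "\<And>x. x \<in> S \<Longrightarrow> f x \<noteq> 0"
  obtains s where "s * s = 1" "\<And>x. x \<in> S \<Longrightarrow> s * f x > 0"
proof (cases "\<forall>x\<in>S. f x > 0")
  case True
  then show ?thesis using that[of 1] by simp
next
  case False
  then obtain x where x: "x \<in> S" "f x < 0" using assms(3) by fastforce
  have "f y < 0" if "y \<in> S" for y
  proof (rule ccontr)
    assume "\<not> f y < 0"
    then have "0 \<in> f ` S"
      using connectedD_interval[OF connected_continuous_image[OF assms(2,1)], of "f x" "f y" 0] x that by auto
    then show False using assms(3) by fastforce
  qed
  then show ?thesis using that[of "-1"] by simp
qed

context timelike_minimal_immersion
begin

text \<open>The expression is \<open>mink w w\<close> for the tangent vector \<open>w\<close> along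
  the level curve of the time component. Having no time component, \<open>w\<close> is spacelike or
  zero.\<close>

lemma time_level_direction_spacelike:
  assumes p: "p \<in> \<Omega>"
  defines "xa \<equiv> snd (snd (\<psi>a p))" and "xb \<equiv> snd (snd (\<psi>b p))"
  shows "gE p * xb\<^sup>2 - 2 * gF p * xa * xb + gG p * xa\<^sup>2 > 0"
proof -
  define w where "w = xb *\<^sub>R \<psi>a p - xa *\<^sub>R \<psi>b p"
  have w3: "snd (snd w) = 0" by (simp add: w_def xa_def xb_def)
  have Q: "gE p * xb\<^sup>2 - 2 * gF p * xa * xb + gG p * xa\<^sup>2 = mink w w"
    unfolding w_def gE_def gF_def gG_def mink_linear
    by (simp add: mink_commute[of "\<psi>b p" "\<psi>a p"] algebra_simps power2_eq_square)
  have D: "(gF p)\<^sup>2 - gE p * gG p > 0" using gD_pos[OF p] by (simp add: gD_def)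
  have "mink w w \<noteq> 0"
  proof
    assume "mink w w = 0"
    then have "fst w = 0" "fst (snd w) = 0"
      using w3 by (auto simp: mink_def add_nonneg_eq_0_iff)
    then have "w = 0" using w3 by (simp add: prod_eq_iff)
    then have "mink (\<psi>a p) w = 0" "mink (\<psi>b p) w = 0" by (simp_all add: mink_linear)
    then have "xb * gE p - xa * gF p = 0" "xb * gF p - xa * gG p = 0"
      unfolding w_def mink_linear gE_def gF_def gG_def by (simp_all add: mink_commute)
    then have "xa * ((gF p)\<^sup>2 - gE p * gG p) = 0" "xb * ((gF p)\<^sup>2 - gE p * gG p) = 0" by algebra+
    then have "xa = 0" "xb = 0" using D by auto
    \<comment> \<open>If \<open>w\<close> vanished, the tangent plane would be horizontal, with a
      Euclidean and hence nonnegative Gram determinant.\<close>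
    then have "gE p * gG p - (gF p)\<^sup>2 = (fst (\<psi>a p) * fst (snd (\<psi>b p)) - fst (snd (\<psi>a p)) * fst (\<psi>b p))\<^sup>2"
      unfolding gE_def gF_def gG_def mink_def xa_def xb_def by (simp add: algebra_simps power2_eq_square)
    then show False using D zero_le_power2[of "fst (\<psi>a p) * fst (snd (\<psi>b p)) - fst (snd (\<psi>a p)) * fst (\<psi>b p)"]
      by linarith
  qed
  moreover have "mink w w \<ge> 0" using w3 by (simp add: mink_def)
  ultimately show ?thesis using Q by linarith
qed

text \<open>The time coordinate of \<open>\<psi>\<close> and a conjugate harmonic function of it serve as global isothermal
  coordinates: no null vector of the metric is mapped by \<open>d\<psi>\<close> into a spacelike plane.\<close>

lemma isothermal_coordinate_exists:
  assumes "simply_connected \<Omega>"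
  shows "\<exists>z. isothermal_coordinate \<Omega> \<psi> z"
proof -
  obtain Y where Y: "\<And>p. p \<in> \<Omega> \<Longrightarrow> (Y has_derivative (\<lambda>v. fst v *\<^sub>R \<omega>a p + snd v *\<^sub>R \<omega>b p)) (at p)"
    and sY: "smooth_on \<Omega> Y"
    using exact_\<omega>[OF assms] by blast
  \<comment> \<open>Time is placed second because v carries the negative sign in the metric.\<close>
  define z where "z p = (snd (snd (Y p)), snd (snd (\<psi> p)))" for p
  define xa where "xa p = snd (snd (\<psi>a p))" for p
  define xb where "xb p = snd (snd (\<psi>b p))" for p
  define ya where "ya p = snd (snd (\<omega>a p))" for p
  define yb where "yb p = snd (snd (\<omega>b p))" for p
  define Q where "Q p = gE p * (xb p)\<^sup>2 - 2 * gF p * xa p * xb p + gG p * (xa p)\<^sup>2" for p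
  have Q: "Q p > 0" if "p \<in> \<Omega>" for p
    unfolding Q_def xa_def xb_def by (rule time_level_direction_spacelike[OF that])
  have y: "gW p * ya p = gF p * xa p - gE p * xb p" "gW p * yb p = gG p * xa p - gF p * xb p" if "p \<in> \<Omega>" for p
    using gW(1)[OF that] unfolding ya_def yb_def \<omega>a_def \<omega>b_def xa_def xb_def by auto
  have bl: "bounded_linear (\<lambda>x::minkowski3. snd (snd x))"
    by (intro bounded_linear_snd_comp bounded_linear_snd)
  have sz: "smooth_on \<Omega> z"
    unfolding z_def by (intro smooth_on_Pair[OF open_domain] smooth_on_linear[OF open_domain bl] sY smooth)
  have z': "frechet_derivative z (at p) =
      (\<lambda>v. (fst v * ya p + snd v * yb p, fst v * xa p + snd v * xb p))" if p: "p \<in> \<Omega>" for p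
  proof (rule frechet_derivativeI)
    have "(\<psi> has_derivative (\<lambda>v. fst v *\<^sub>R \<psi>a p + snd v *\<^sub>R \<psi>b p)) (at p)"
      using smooth_on_has_derivative[OF smooth p]
      by (rule has_derivative_eq_rhs) (rule ext, rule frechet_derivative_\<psi>[OF p])
    from has_derivative_Pair[OF bounded_linear.has_derivative[OF bl Y[OF p]] bounded_linear.has_derivative[OF bl this]]
    show "(z has_derivative (\<lambda>v. (fst v * ya p + snd v * yb p, fst v * xa p + snd v * xb p))) (at p)"
      by (simp add: z_def[abs_def] xa_def xb_def ya_def yb_def)
  qed
  have "isothermal_coordinate \<Omega> \<psi> z"
    unfolding isothermal_coordinate_def coordinate_on_def
  \<comment> \<open>In the dual metric the differential of the time component has square -Q/gD; the
    conformal factor is minus its reciprocal.\<close>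
  proof (intro conjI ballI exI[of _ "\<lambda>p. gD p / Q p"] allI sz)
    fix p assume p: "p \<in> \<Omega>"
    have W: "gW p > 0" "gW p * gW p = gD p" using gW p by auto
    show "gD p / Q p > 0" using gD_pos[OF p] Q[OF p] by simp
    \<comment> \<open>The same positive \<open>Q\<close> that gives the conformal factor also bounds
      the Jacobian away from zero pointwise.\<close>
    have "gW p * (ya p * xb p - yb p * xa p) = - Q p"
      using y[OF p] unfolding Q_def by algebra
    then have "ya p * xb p - yb p * xa p \<noteq> 0" using Q[OF p] W(1) by auto
    then show "bij (frechet_derivative z (at p))"
      using bij_real_prod_det[OF smooth_on_imp_linear[OF sz p]] unfolding z'[OF p] by simp
    fix w
    have "Q p * first_form \<psi> p w w = (gW p * (fst w * ya p + snd w * yb p))\<^sup>2 - gW p * gW p * (fst w * xa p + snd w * xb p)\<^sup>2"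
    proof -
      have e: "gW p * (fst w * ya p + snd w * yb p) =
          fst w * (gF p * xa p - gE p * xb p) + snd w * (gG p * xa p - gF p * xb p)"
        using y[OF p] by algebra
      show ?thesis
        unfolding e W(2) gD_def first_form_eq[OF p] Q_def by (simp add: algebra_simps power2_eq_square)
    qed
    also have "\<dots> = gD p * ((fst w * ya p + snd w * yb p)\<^sup>2 - (fst w * xa p + snd w * xb p)\<^sup>2)"
      unfolding W(2)[symmetric] by (simp add: algebra_simps power2_eq_square)
    finally show "first_form \<psi> p w w = gD p / Q p *
        ((fst (frechet_derivative z (at p) w))\<^sup>2 - (snd (frechet_derivative z (at p) w))\<^sup>2)"
      unfolding z'[OF p] using Q[OF p] by (simp add: field_simps)
  qed
  then show ?thesis by blast
qed

text \<open>In an orthogonal frame with squares \<open>l\<close> and \<open>- l\<close> the star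
  interchanges the two derivatives, up to a sign fixed by the orientation \<open>s\<close> of the
  frame.\<close>

lemma \<omega>_isothermal:
  assumes p: "p \<in> \<Omega>" and l: "l > 0"
    and UV: "first_form \<psi> p U U = l" "first_form \<psi> p V V = - l" "first_form \<psi> p U V = 0"
    and s: "s * s = 1" "s * (fst U * snd V - snd U * fst V) > 0"
  shows "fst U *\<^sub>R \<omega>a p + snd U *\<^sub>R \<omega>b p = - s *\<^sub>R frechet_derivative \<psi> (at p) V"
    and "fst V *\<^sub>R \<omega>a p + snd V *\<^sub>R \<omega>b p = - s *\<^sub>R frechet_derivative \<psi> (at p) U"
proof -
  define e where "e = fst U * snd V - snd U * fst V"
  have W: "gW p > 0" "gW p * gW p = (gF p)\<^sup>2 - gE p * gG p" using gW[OF p] by (auto simp: gD_def)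
  have e0: "s * e > 0" unfolding e_def by (rule s)
  note ff = UV[unfolded first_form_eq[OF p]]
  have "(e * gW p)\<^sup>2 = l\<^sup>2"
  proof -
    have "(e * gW p)\<^sup>2 = e * e * (gW p * gW p)" by (simp add: power2_eq_square)
    also have "\<dots> = (first_form \<psi> p U V)\<^sup>2 - first_form \<psi> p U U * first_form \<psi> p V V"
      unfolding W(2) e_def first_form_eq[OF p] by (simp add: algebra_simps power2_eq_square)
    also have "\<dots> = l\<^sup>2" unfolding UV by (simp add: power2_eq_square)
    finally show ?thesis .
  qed
  then have "(s * e * gW p)\<^sup>2 = l\<^sup>2" using s(1) by algebra
  \<comment> \<open>Comparing Gram determinants determines \<open>e * gW p\<close> up to sign; the
    orientation chooses the sign.\<close>
  then have l_eq: "s * e * gW p = l" using e0 W(1) l by (simp add: power2_eq_iff_nonneg)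
  \<comment> \<open>These are the inner products of \<open>U\<close> and \<open>V\<close> with the
    two given coordinate vectors. The frame relations \<open>mn\<close> are linear systems for them
    with determinant \<open>e\<close> up to sign.\<close>
  define m n m' n' where "m = fst U * gE p + snd U * gF p" and "n = fst U * gF p + snd U * gG p"
    and "m' = fst V * gE p + snd V * gF p" and "n' = fst V * gF p + snd V * gG p"
  have mn: "m * fst V + n * snd V = 0" "m * fst U + n * snd U = l"
    "m' * fst U + n' * snd U = 0" "m' * fst V + n' * snd V = - l"
    using ff unfolding m_def n_def m'_def n'_def by (simp_all add: algebra_simps)
  have "e \<noteq> 0" using e0 by auto
  have "e * m = e * (s * gW p * snd V)" "e * n = e * (- (s * gW p * fst V))"
    "e * m' = e * (s * gW p * snd U)" "e * n' = e * (- (s * gW p * fst U))"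
    using mn l_eq unfolding e_def by algebra+
  then have sol: "m = s * gW p * snd V" "n = - (s * gW p * fst V)"
    "m' = s * gW p * snd U" "n' = - (s * gW p * fst U)"
    using \<open>e \<noteq> 0\<close> by (simp_all only: mult_cancel_left simp_thms)
  have \<omega>: "fst X *\<^sub>R \<omega>a p + snd X *\<^sub>R \<omega>b p = inverse (gW p) *\<^sub>R
      ((fst X * gF p + snd X * gG p) *\<^sub>R \<psi>a p - (fst X * gE p + snd X * gF p) *\<^sub>R \<psi>b p)" for X
    unfolding \<omega>a_def \<omega>b_def by (simp add: algebra_simps)
  show "fst U *\<^sub>R \<omega>a p + snd U *\<^sub>R \<omega>b p = - s *\<^sub>R frechet_derivative \<psi> (at p) V"
    unfolding \<omega> m_def[symmetric] n_def[symmetric] sol frechet_derivative_\<psi>[OF p]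
    using W(1) by (simp add: algebra_simps)
  show "fst V *\<^sub>R \<omega>a p + snd V *\<^sub>R \<omega>b p = - s *\<^sub>R frechet_derivative \<psi> (at p) U"
    unfolding \<omega> m'_def[symmetric] n'_def[symmetric] sol frechet_derivative_\<psi>[OF p]
    using W(1) by (simp add: algebra_simps)
qed

text \<open>The definition prescribes only the quadratic form; its value on the null vector
  \<open>U + V\<close> yields the mixed term.\<close>

lemma isothermal_orthogonal:
  assumes z: "isothermal_coordinate \<Omega> \<psi> z" and p: "p \<in> \<Omega>"
  defines "U \<equiv> inv (frechet_derivative z (at p)) (1, 0)" and "V \<equiv> inv (frechet_derivative z (at p)) (0, 1)"
  obtains l where "l > 0" "first_form \<psi> p U U = l" "first_form \<psi> p V V = - l" "first_form \<psi> p U V = 0"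
proof -
  obtain l where l: "l > 0" "\<And>w. first_form \<psi> p w w =
      l * ((fst (frechet_derivative z (at p) w))\<^sup>2 - (snd (frechet_derivative z (at p) w))\<^sup>2)"
    using z p unfolding isothermal_coordinate_def by blast
  have sz: "smooth_on \<Omega> z" and bz: "bij (frechet_derivative z (at p))"
    using z p by (auto simp: isothermal_coordinate_def coordinate_on_def)
  have UV: "frechet_derivative z (at p) U = (1, 0)" "frechet_derivative z (at p) V = (0, 1)"
    unfolding U_def V_def by (simp_all add: bij_is_surj[OF bz] surj_f_inv_f)
  have ff: "first_form \<psi> p U U = l" "first_form \<psi> p V V = - l" "first_form \<psi> p (U + V) (U + V) = 0"
    unfolding l linear_add[OF smooth_on_imp_linear[OF sz p]] UV by simp_all
  moreover have "first_form \<psi> p (U + V) (U + V) = first_form \<psi> p U U + 2 * first_form \<psi> p U V + first_form \<psi> p V V"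
    unfolding first_form_eq[OF p] by (simp add: algebra_simps)
  ultimately show thesis using l(1) that by simp
qed

lemma conjugate_immersion:
  assumes "simply_connected \<Omega>" and z: "isothermal_coordinate \<Omega> \<psi> z"
  obtains y where "smooth_on \<Omega> y" "\<And>p. p \<in> \<Omega> \<Longrightarrow> du z y p = dv z \<psi> p" "\<And>p. p \<in> \<Omega> \<Longrightarrow> dv z y p = du z \<psi> p"
proof -
  obtain Y where Y: "\<And>p. p \<in> \<Omega> \<Longrightarrow> (Y has_derivative (\<lambda>v. fst v *\<^sub>R \<omega>a p + snd v *\<^sub>R \<omega>b p)) (at p)"
    and sY: "smooth_on \<Omega> Y"
    using exact_\<omega>[OF assms(1)] by blast
  have bz: "bij (frechet_derivative z (at p))" if "p \<in> \<Omega>" for p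
    using z that by (auto simp: isothermal_coordinate_def coordinate_on_def)
  have sz: "smooth_on \<Omega> z" using z by (auto simp: isothermal_coordinate_def coordinate_on_def)
  define za where "za q = frechet_derivative z (at q) (1, 0)" for q
  define zb where "zb q = frechet_derivative z (at q) (0, 1)" for q
  define \<delta> where "\<delta> q = fst (za q) * snd (zb q) - fst (zb q) * snd (za q)" for q
  have \<delta>0: "\<delta> q \<noteq> 0" if "q \<in> \<Omega>" for q
    unfolding \<delta>_def za_def zb_def by (rule bij_real_prod_imp_det[OF smooth_on_imp_linear[OF sz that] bz[OF that]])
  have c\<delta>: "continuous_on \<Omega> \<delta>"
    unfolding \<delta>_def za_def zb_def
    by (intro continuous_intros smooth_on_imp_continuous_on smooth_on_frechet_derivative sz)
  obtain s where s: "s * s = 1" "\<And>q. q \<in> \<Omega> \<Longrightarrow> s * \<delta> q > 0"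
    by (rule connected_nonzero_sgn_const[OF simply_connected_imp_connected[OF assms(1)] c\<delta> \<delta>0]) blast+
  define y where "y = (\<lambda>p. - s *\<^sub>R Y p)"
  have y': "(y has_derivative (\<lambda>v. - s *\<^sub>R (fst v *\<^sub>R \<omega>a p + snd v *\<^sub>R \<omega>b p))) (at p)" if "p \<in> \<Omega>" for p
    unfolding y_def by (intro has_derivative_scaleR_right Y that)
  have "du z y p = dv z \<psi> p \<and> dv z y p = du z \<psi> p" if p: "p \<in> \<Omega>" for p
  proof -
    define U V where "U = inv (frechet_derivative z (at p)) (1, 0)" and "V = inv (frechet_derivative z (at p)) (0, 1)"
    obtain l where l: "l > 0" "first_form \<psi> p U U = l" "first_form \<psi> p V V = - l" "first_form \<psi> p U V = 0"
      using isothermal_orthogonal[OF z p] unfolding U_def V_def by blast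
    have UV: "U = (snd (zb p) / \<delta> p, - snd (za p) / \<delta> p)" "V = (- fst (zb p) / \<delta> p, fst (za p) / \<delta> p)"
      unfolding U_def V_def inv_real_prod[OF smooth_on_imp_linear[OF sz p] bz[OF p]] \<delta>_def za_def zb_def by simp_all
    \<comment> \<open>The frame has determinant one over the Jacobian of \<open>z\<close>; in this
      shape its sign is visibly that of the Jacobian.\<close>
    have "fst U * snd V - snd U * fst V = \<delta> p / (\<delta> p * \<delta> p)"
      unfolding UV by (simp add: diff_divide_distrib[symmetric]) (simp add: \<delta>_def mult.commute)
    then have "s * (fst U * snd V - snd U * fst V) = s * \<delta> p / (\<delta> p * \<delta> p)" by simp
    moreover have "\<delta> p * \<delta> p > 0" using \<delta>0[OF p] by (metis not_real_square_gt_zero)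
    ultimately have "s * (fst U * snd V - snd U * fst V) > 0"
      using divide_pos_pos[OF s(2)[OF p]] by metis
    note * = \<omega>_isothermal[OF p l s(1) this]
    show ?thesis
      unfolding coord_deriv_eq[OF y'[OF p]] U_def[symmetric] V_def[symmetric] *
      using s(1) by (simp add: coord_deriv_def U_def V_def)
  qed
  moreover have "smooth_on \<Omega> y"
    unfolding y_def by (rule smooth_on_linear[OF open_domain bounded_linear_scaleR_right sY])
  ultimately show thesis using that by blast
qed

lemma Enneper_representation:
  assumes "simply_connected \<Omega>" and z: "isothermal_coordinate \<Omega> \<psi> z"
  defines "h \<equiv> \<lambda>p. fst (\<psi> p)"
  shows "harmonic_on z \<Omega> h" "Enneper_timelike_immersion z \<Omega> h \<psi>"
proof -
  obtain y where sy: "smooth_on \<Omega> y" and y: "\<And>p. p \<in> \<Omega> \<Longrightarrow> du z y p = dv z \<psi> p" "\<And>p. p \<in> \<Omega> \<Longrightarrow> dv z y p = du z \<psi> p"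
    using conjugate_immersion[OF assms(1,2)] by blast
  have cz: "coordinate_on \<Omega> z" using z by (simp add: isothermal_coordinate_def)
  have linear_coord: "coord_deriv z c (\<lambda>q. L (f q)) p = L (coord_deriv z c f p)"
    if "bounded_linear L" "smooth_on \<Omega> f" "p \<in> \<Omega>"
    for c p and f :: "paracomplex \<Rightarrow> 'x::real_normed_vector" and L :: "'x \<Rightarrow> 'y::real_normed_vector"
    using coord_deriv_eq[OF bounded_linear.has_derivative[OF that(1) smooth_on_has_derivative[OF that(2,3)]]]
    by (simp add: coord_deriv_def)
  show "harmonic_on z \<Omega> h"
    unfolding harmonic_on_def
  proof (intro conjI ballI)
    have sh: "smooth_on \<Omega> h" unfolding h_def by (rule smooth_on_linear[OF open_domain bounded_linear_fst smooth])
    then show "Ck_on 2 \<Omega> h" by (simp add: smooth_on_def)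
    fix p assume p: "p \<in> \<Omega>"
    \<comment> \<open>The harmonic conjugate of \<open>h\<close>: h_u = k_v and h_v = k_u, so h_uu
      and h_vv are the two mixed derivatives of \<open>k\<close>.\<close>
    define k where "k = (\<lambda>q. fst (y q))"
    have sk: "smooth_on \<Omega> k" unfolding k_def by (rule smooth_on_linear[OF open_domain bounded_linear_fst sy])
    have hk: "du z h q = dv z k q" "dv z h q = du z k q" if "q \<in> \<Omega>" for q
      unfolding h_def k_def linear_coord[OF bounded_linear_fst smooth that] linear_coord[OF bounded_linear_fst sy that]
      by (simp_all add: y[OF that])
    have cong: "coord_deriv z c (coord_deriv z d h) p = coord_deriv z c (coord_deriv z e k) p"
      if "\<And>q. q \<in> \<Omega> \<Longrightarrow> coord_deriv z d h q = coord_deriv z e k q" for c d e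
    proof -
      have d: "coord_deriv z d h differentiable (at p)"
        using has_derivative_coord_deriv[OF open_domain p cz sh] by (rule differentiableI)
      show ?thesis
        unfolding coord_deriv_def[of z c "coord_deriv z d h"] coord_deriv_def[of z c "coord_deriv z e k"]
        by (rule fun_cong[OF frechet_derivative_transform_within_open[OF d open_domain p that]])
    qed
    show "du z (du z h) p - dv z (dv z h) p = 0"
      using cong[OF hk(1), of "(1, 0)"] cong[OF hk(2), of "(0, 1)"] coord_deriv_commute[OF open_domain p cz sk, of "(1, 0)" "(0, 1)"]
      by simp
  qed
  \<comment> \<open>Written as real linear maps of the pair (\<psi>, y), \<open>L\<close> and
    \<open>P\<close> inherit smoothness and coordinate derivatives directly from that pair.\<close>
  define T where "T = (\<lambda>x :: minkowski3 \<times> minkowski3.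
    (1/2) *\<^sub>R (fst (snd (fst x)) + snd (snd (snd x)), fst (snd (snd x)) + snd (snd (fst x))))"
  define T' where "T' = (\<lambda>x :: minkowski3 \<times> minkowski3.
    (- 1/2) *\<^sub>R (fst (snd (fst x)) - snd (snd (snd x)), fst (snd (snd x)) - snd (snd (fst x))))"
  have bT: "bounded_linear T" "bounded_linear T'"
    unfolding linear_conv_bounded_linear[symmetric] T_def T'_def
    by (auto intro!: linearI simp: algebra_simps add_divide_distrib)
  define L P where "L = (\<lambda>p. T (\<psi> p, y p))" and "P = (\<lambda>p. T' (\<psi> p, y p))"
  have s\<psi>y: "smooth_on \<Omega> (\<lambda>p. (\<psi> p, y p))" by (rule smooth_on_Pair[OF open_domain smooth sy])
  have c\<psi>y: "coord_deriv z c (\<lambda>p. (\<psi> p, y p)) p = (coord_deriv z c \<psi> p, coord_deriv z c y p)" if "p \<in> \<Omega>" for c p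
    using coord_deriv_eq[OF has_derivative_Pair[OF smooth_on_has_derivative[OF smooth that] smooth_on_has_derivative[OF sy that]]]
    by (simp add: coord_deriv_def)
  have cL: "coord_deriv z c L p = T (coord_deriv z c \<psi> p, coord_deriv z c y p)"
    and cP: "coord_deriv z c P p = T' (coord_deriv z c \<psi> p, coord_deriv z c y p)" if "p \<in> \<Omega>" for c p
    unfolding L_def P_def linear_coord[OF bT(1) s\<psi>y that] linear_coord[OF bT(2) s\<psi>y that] c\<psi>y[OF that] by auto
  have sLP: "smooth_on \<Omega> L" "smooth_on \<Omega> P"
    unfolding L_def P_def
    by (rule smooth_on_linear[OF open_domain bT(1) s\<psi>y] smooth_on_linear[OF open_domain bT(2) s\<psi>y])+
  have diff: "L_differentiable_on z \<Omega> L" "L_differentiable_on z \<Omega> P"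
  proof -
    have "d_zbar z L p = 0" "d_zbar z P p = 0" if "p \<in> \<Omega>" for p
      unfolding d_zbar_def cL[OF that] cP[OF that] y[OF that] T_def T'_def tau_def pc_mult_def
      by (rule prod_eqI; simp)+
    then show "L_differentiable_on z \<Omega> L" "L_differentiable_on z \<Omega> P"
      using sLP unfolding L_differentiable_on_def smooth_on_def by blast+
  qed
  show "Enneper_timelike_immersion z \<Omega> h \<psi>"
    unfolding Enneper_timelike_immersion_def Let_def
  proof (rule exI[of _ L], rule exI[of _ P], intro conjI ballI diff)
    fix p assume p: "p \<in> \<Omega>"
    define A B where "A = du z \<psi> p" and "B = dv z \<psi> p"
    define U V where "U = inv (frechet_derivative z (at p)) (1, 0)" and "V = inv (frechet_derivative z (at p)) (0, 1)"
    obtain l where l: "l > 0" "first_form \<psi> p U U = l" "first_form \<psi> p V V = - l" "first_form \<psi> p U V = 0"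
      using isothermal_orthogonal[OF z p] unfolding U_def V_def by blast
    have AB: "mink A A = l" "mink B B = - l" "mink A B = 0"
      using l(2-4) unfolding first_form_def A_def B_def coord_deriv_def U_def V_def by auto
    have bh: "bounded_linear (\<lambda>x::minkowski3. pc_of_real (fst x))"
      unfolding pc_of_real_def by (intro bounded_linear_Pair bounded_linear_fst bounded_linear_zero)
    have hz: "d_z z (\<lambda>q. pc_of_real (h q)) p = (1/2) *\<^sub>R (fst A, fst B)"
      unfolding d_z_def h_def linear_coord[OF bh smooth p] A_def B_def
      by (rule prod_eqI; simp add: tau_def pc_mult_def pc_of_real_def)
    have Lz: "d_z z L p = (1/2) *\<^sub>R (fst (snd A) + snd (snd B), fst (snd B) + snd (snd A))"
      and Pz: "d_z z P p = (- 1/2) *\<^sub>R (fst (snd A) - snd (snd B), fst (snd B) - snd (snd A))"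
      unfolding d_z_def cL[OF p] cP[OF p] y[OF p] A_def[symmetric] B_def[symmetric] T_def T'_def
      by (rule prod_eqI; simp add: tau_def pc_mult_def add_divide_distrib diff_divide_distrib)+
    \<comment> \<open>The contributions of the conjugate map \<open>y\<close> cancel between
      \<open>L\<close> and the conjugate of \<open>P\<close>.\<close>
    show "\<psi> p = (h p, L p - pc_cnj (P p))"
      unfolding h_def L_def P_def T_def T'_def pc_cnj_def
      by (rule prod_eqI, simp, rule prod_eqI; simp add: add_divide_distrib diff_divide_distrib)
    show "d_z z (\<lambda>q. pc_of_real (h q)) p \<odot> d_z z (\<lambda>q. pc_of_real (h q)) p = d_z z L p \<odot> d_z z P p"
    proof -
      \<comment> \<open>The real part of the identity is \<open>mink A A + mink B B = 0\<close>, the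
        \<tau> part below is \<open>mink A B = 0\<close>.\<close>
      have "fst A * fst A + fst B * fst B = - ((fst (snd A) + snd (snd B)) * (fst (snd A) - snd (snd B))
          + (fst (snd B) + snd (snd A)) * (fst (snd B) - snd (snd A)))"
        using AB(1,2) unfolding mink_def by (simp add: algebra_simps)
      moreover have "fst A * fst B + fst B * fst A = - ((fst (snd A) + snd (snd B)) * (fst (snd B) - snd (snd A))
          + (fst (snd B) + snd (snd A)) * (fst (snd A) - snd (snd B)))"
        using AB(3) unfolding mink_def by (simp add: algebra_simps)
      ultimately have key: "(fst A, fst B) \<odot> (fst A, fst B) = - ((fst (snd A) + snd (snd B), fst (snd B) + snd (snd A))
          \<odot> (fst (snd A) - snd (snd B), fst (snd B) - snd (snd A)))"
        unfolding pc_mult_def fst_conv snd_conv by (simp only: uminus_Pair)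
      have half: "((1/2) *\<^sub>R x) \<odot> ((1/2) *\<^sub>R x) = (1/4) *\<^sub>R (x \<odot> x)"
        "((1/2) *\<^sub>R x) \<odot> ((- 1/2) *\<^sub>R y) = (1/4) *\<^sub>R (- (x \<odot> y))" for x y :: paracomplex
        by (simp_all add: pc_mult_def add_divide_distrib)
      show ?thesis
        unfolding hz Lz Pz half key ..
    qed
    \<comment> \<open>A product with the conjugate is real, so the first component decides
      nonvanishing. The terms have indefinite sign individually; only their sum is the positive
      factor \<open>l\<close>.\<close>
    have norm: "fst ((c *\<^sub>R x) \<odot> pc_cnj (c *\<^sub>R x)) = c * c * (fst x * fst x - snd x * snd x)" for c x
      by (simp add: pc_mult_def pc_cnj_def algebra_simps)
    have "fst (2 *\<^sub>R (d_z z (\<lambda>q. pc_of_real (h q)) p \<odot> pc_cnj (d_z z (\<lambda>q. pc_of_real (h q)) p))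
        + d_z z L p \<odot> pc_cnj (d_z z L p) + d_z z P p \<odot> pc_cnj (d_z z P p)) = (mink A A - mink B B) / 2"
      unfolding hz Lz Pz fst_add fst_scaleR norm mink_def by (simp add: algebra_simps)
    also have "\<dots> = l" using AB by simp
    finally show "2 *\<^sub>R (d_z z (\<lambda>q. pc_of_real (h q)) p \<odot> pc_cnj (d_z z (\<lambda>q. pc_of_real (h q)) p))
        + d_z z L p \<odot> pc_cnj (d_z z L p) + d_z z P p \<odot> pc_cnj (d_z z P p) \<noteq> 0"
      using l(1) by (metis fst_zero less_irrefl)
  qed
qed

end

theorem theorem5p5:
  fixes \<Omega> :: "paracomplex set" and \<psi> :: "paracomplex \<Rightarrow> minkowski3"
  assumes "open \<Omega>" and "\<Omega> \<noteq> {}" and "simply_connected \<Omega>"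
    and "timelike_immersion \<Omega> \<psi>" and "minimal_on \<Omega> \<psi>"
  shows "(\<exists>z. isothermal_coordinate \<Omega> \<psi> z) \<and>
    (\<forall>z. isothermal_coordinate \<Omega> \<psi> z \<longrightarrow>
      (\<exists>h. harmonic_on z \<Omega> h \<and>
        Enneper_timelike_immersion z \<Omega> h \<psi> \<and> Enneper_graph z \<Omega> h (\<psi> ` \<Omega>)))"
proof -
  interpret timelike_minimal_immersion \<Omega> \<psi>
    using assms by unfold_locales
  show ?thesis
    using isothermal_coordinate_exists[OF assms(3)] Enneper_representation[OF assms(3)]
    unfolding Enneper_graph_def by blast
qed

end
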